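(* Let $k$ be a commutative ring and let $\mathcal{A},\mathcal{B}$ be locally presentable $k$-linear categories. Then there exists an equivalence $$\mathcal{A}\boxtimes_{\mathsf{LP}}\mathcal{B}\cong\mathcal{B}\boxtimes_{\mathsf{LP}}\mathcal{A}.$$
   Context: "Small" is with respect to a fixed universe and $k$ is a small commutative ring. An object $C$ of a $k$-linear category $\mathcal{C}$ is $\alpha$-presentable if $\mathcal{C}(C,-):\mathcal{C}\to\mathsf{Mod}(k)$ preserves $\alpha$-filtered colimits. $\mathcal{C}$ is locally $\alpha$-presentable if it is cocomplete and has a small set of $\alpha$-presentable objects such that every object is an $\alpha$-filtered colimit of objects in this set; locally presentable means locally $\alpha$-presentable for some small regular cardinal $\alpha$. The tensor product of locally presentable $k$-linear categories is the locally presentable $k$-linear category $\mathcal{A}\boxtimes_{\mathsf{LP}}\mathcal{B}=\mathsf{Cont}(\mathcal{A}^{\mathrm{op}},\mathcal{B})$ of continuous (small-limit preserving) $k$-linear functors $\mathcal{A}^{\mathrm{op}}\to\mathcal{B}$; cocontinuous $k$-linear functors from it to a locally presentable $k$-linear category $\mathcal{E}$ correspond to $k$-linear functors $\mathcal{A}\otimes\mathcal{B}\to\mathcal{E}$ that are cocontinuous in each variable, where $\otimes$ is the tensor product of $k$-linear categories (objects are pairs, Hom-modules are tensor products over $k$). *)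

theory Defs
  imports "HOL-Algebra.Module" "HOL-Library.FuncSet"
begin

unbundle cardinal_syntax

section \<open>Universe and smallness\<close>

text \<open>
  The fixed universe is modelled by a type \<open>'u\<close> whose cardinality is uncountable and strongly
  inaccessible, as that of a Grothendieck universe is. A set, of whatever type, is small if it has
  fewer elements than \<open>'u\<close>; these are, up to bijection, the members of the universe. Every small
  set has a copy inside \<open>'u\<close>, so small index categories and small modules may be taken to
  live on \<open>'u\<close>, and so may the Hom-sets of a category with small Hom-sets.
\<close>

definition universe :: "'u itself \<Rightarrow> bool" where
  "universe _ \<longleftrightarrow>
     natLeq <o |UNIV :: 'u set| \<and>
     regularCard |UNIV :: 'u set| \<and>
     (\<forall>S :: 'u set. |S| <o |UNIV :: 'u set| \<longrightarrow> |Pow S| <o |UNIV :: 'u set| )"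

definition small :: "'u itself \<Rightarrow> 's set \<Rightarrow> bool" where
  "small _ S \<longleftrightarrow> |S| <o |UNIV :: 'u set|"

definition small_regular_cardinal :: "'u rel \<Rightarrow> bool" where
  "small_regular_cardinal \<alpha> \<longleftrightarrow> Cinfinite \<alpha> \<and> regularCard \<alpha> \<and> \<alpha> <o |UNIV :: 'u set|"


section \<open>Categories and functors\<close>

text \<open>
  Hom-sets of different pairs of objects need not be disjoint, so the operations on arrows take the
  objects as arguments: \<open>Comp C X Y Z g f\<close> is the composite of \<open>f : X \<rightarrow> Y\<close> and
  \<open>g : Y \<rightarrow> Z\<close>.
\<close>

record ('o, 'm) cat =
  Obj :: "'o set"
  Hom :: "'o \<Rightarrow> 'o \<Rightarrow> 'm set"
  Ident :: "'o \<Rightarrow> 'm"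
  Comp :: "'o \<Rightarrow> 'o \<Rightarrow> 'o \<Rightarrow> 'm \<Rightarrow> 'm \<Rightarrow> 'm"

locale category =
  fixes C :: "('o, 'm, 'z) cat_scheme"
  assumes Ident_closed: "X \<in> Obj C \<Longrightarrow> Ident C X \<in> Hom C X X"
    and Comp_closed:
      "\<lbrakk>X \<in> Obj C; Y \<in> Obj C; Z \<in> Obj C; f \<in> Hom C X Y; g \<in> Hom C Y Z\<rbrakk>
        \<Longrightarrow> Comp C X Y Z g f \<in> Hom C X Z"
    and Comp_Ident_right:
      "\<lbrakk>X \<in> Obj C; Y \<in> Obj C; f \<in> Hom C X Y\<rbrakk> \<Longrightarrow> Comp C X X Y f (Ident C X) = f"
    and Comp_Ident_left:
      "\<lbrakk>X \<in> Obj C; Y \<in> Obj C; f \<in> Hom C X Y\<rbrakk> \<Longrightarrow> Comp C X Y Y (Ident C Y) f = f"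
    and Comp_assoc:
      "\<lbrakk>W \<in> Obj C; X \<in> Obj C; Y \<in> Obj C; Z \<in> Obj C;
        f \<in> Hom C W X; g \<in> Hom C X Y; h \<in> Hom C Y Z\<rbrakk>
        \<Longrightarrow> Comp C W Y Z h (Comp C W X Y g f) = Comp C W X Z (Comp C X Y Z h g) f"

definition arrows :: "('o, 'm, 'z) cat_scheme \<Rightarrow> ('o \<times> 'o \<times> 'm) set" where
  "arrows C = {(X, Y, f). X \<in> Obj C \<and> Y \<in> Obj C \<and> f \<in> Hom C X Y}"

record ('o, 'm, 'p, 'n) ftor =
  fobj :: "'o \<Rightarrow> 'p"
  farr :: "'o \<Rightarrow> 'o \<Rightarrow> 'm \<Rightarrow> 'n"

locale cat_functor = dom: category C + cod: category D
  for C :: "('o, 'm, 'y) cat_scheme" and D :: "('p, 'n, 'z) cat_scheme" +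
  fixes F :: "('o, 'm, 'p, 'n) ftor"
  assumes fobj_closed: "X \<in> Obj C \<Longrightarrow> fobj F X \<in> Obj D"
    and farr_closed:
      "\<lbrakk>X \<in> Obj C; Y \<in> Obj C; f \<in> Hom C X Y\<rbrakk> \<Longrightarrow> farr F X Y f \<in> Hom D (fobj F X) (fobj F Y)"
    and farr_Ident: "X \<in> Obj C \<Longrightarrow> farr F X X (Ident C X) = Ident D (fobj F X)"
    and farr_Comp:
      "\<lbrakk>X \<in> Obj C; Y \<in> Obj C; Z \<in> Obj C; f \<in> Hom C X Y; g \<in> Hom C Y Z\<rbrakk>
        \<Longrightarrow> farr F X Z (Comp C X Y Z g f)
            = Comp D (fobj F X) (fobj F Y) (fobj F Z) (farr F Y Z g) (farr F X Y f)"

definition id_ftor :: "('o, 'm, 'o, 'm) ftor" where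
  "id_ftor = \<lparr>fobj = (\<lambda>X. X), farr = (\<lambda>X Y f. f)\<rparr>"

definition comp_ftor ::
    "('p, 'n, 'q, 'l) ftor \<Rightarrow> ('o, 'm, 'p, 'n) ftor \<Rightarrow> ('o, 'm, 'q, 'l) ftor" where
  "comp_ftor G F =
     \<lparr>fobj = (\<lambda>X. fobj G (fobj F X)),
      farr = (\<lambda>X Y f. farr G (fobj F X) (fobj F Y) (farr F X Y f))\<rparr>"

text \<open>The values of a functor off its domain are junk; this fixes them, so that functors with
  the same values on \<open>C\<close> are equal.\<close>

definition ftor_extensional :: "('o, 'm, 'y) cat_scheme \<Rightarrow> ('o, 'm, 'p, 'n) ftor \<Rightarrow> bool" where
  "ftor_extensional C F \<longleftrightarrow>
     fobj F \<in> extensional (Obj C) \<and>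
     (\<forall>X Y f. \<not> (X \<in> Obj C \<and> Y \<in> Obj C \<and> f \<in> Hom C X Y) \<longrightarrow> farr F X Y f = undefined)"

definition nat_trans ::
    "('o, 'm, 'y) cat_scheme \<Rightarrow> ('p, 'n, 'z) cat_scheme \<Rightarrow>
     ('o, 'm, 'p, 'n) ftor \<Rightarrow> ('o, 'm, 'p, 'n) ftor \<Rightarrow> ('o \<Rightarrow> 'n) \<Rightarrow> bool" where
  "nat_trans C D F G t \<longleftrightarrow>
     (\<forall>X\<in>Obj C. t X \<in> Hom D (fobj F X) (fobj G X)) \<and>
     (\<forall>X\<in>Obj C. \<forall>Y\<in>Obj C. \<forall>f\<in>Hom C X Y.
        Comp D (fobj F X) (fobj F Y) (fobj G Y) (t Y) (farr F X Y f)
        = Comp D (fobj F X) (fobj G X) (fobj G Y) (farr G X Y f) (t X))"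

definition is_iso :: "('o, 'm, 'z) cat_scheme \<Rightarrow> 'o \<Rightarrow> 'o \<Rightarrow> 'm \<Rightarrow> bool" where
  "is_iso C X Y f \<longleftrightarrow>
     f \<in> Hom C X Y \<and>
     (\<exists>g\<in>Hom C Y X. Comp C X Y X g f = Ident C X \<and> Comp C Y X Y f g = Ident C Y)"

definition nat_iso ::
    "('o, 'm, 'y) cat_scheme \<Rightarrow> ('p, 'n, 'z) cat_scheme \<Rightarrow>
     ('o, 'm, 'p, 'n) ftor \<Rightarrow> ('o, 'm, 'p, 'n) ftor \<Rightarrow> ('o \<Rightarrow> 'n) \<Rightarrow> bool" where
  "nat_iso C D F G t \<longleftrightarrow>
     nat_trans C D F G t \<and> (\<forall>X\<in>Obj C. is_iso D (fobj F X) (fobj G X) (t X))"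


section \<open>Limits and colimits\<close>

definition is_cocone ::
    "('i, 'a, 'y) cat_scheme \<Rightarrow> ('o, 'm, 'z) cat_scheme \<Rightarrow> ('i, 'a, 'o, 'm) ftor \<Rightarrow>
     'o \<Rightarrow> ('i \<Rightarrow> 'm) \<Rightarrow> bool" where
  "is_cocone J C D c l \<longleftrightarrow>
     c \<in> Obj C \<and>
     (\<forall>i\<in>Obj J. l i \<in> Hom C (fobj D i) c) \<and>
     (\<forall>i\<in>Obj J. \<forall>j\<in>Obj J. \<forall>u\<in>Hom J i j.
        Comp C (fobj D i) (fobj D j) c (l j) (farr D i j u) = l i)"

definition is_colimit ::
    "('i, 'a, 'y) cat_scheme \<Rightarrow> ('o, 'm, 'z) cat_scheme \<Rightarrow> ('i, 'a, 'o, 'm) ftor \<Rightarrow>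
     'o \<Rightarrow> ('i \<Rightarrow> 'm) \<Rightarrow> bool" where
  "is_colimit J C D c l \<longleftrightarrow>
     is_cocone J C D c l \<and>
     (\<forall>c' l'. is_cocone J C D c' l' \<longrightarrow>
        (\<exists>!h. h \<in> Hom C c c' \<and> (\<forall>i\<in>Obj J. Comp C (fobj D i) c c' h (l i) = l' i)))"

definition is_cone ::
    "('i, 'a, 'y) cat_scheme \<Rightarrow> ('o, 'm, 'z) cat_scheme \<Rightarrow> ('i, 'a, 'o, 'm) ftor \<Rightarrow>
     'o \<Rightarrow> ('i \<Rightarrow> 'm) \<Rightarrow> bool" where
  "is_cone J C D c l \<longleftrightarrow>
     c \<in> Obj C \<and>
     (\<forall>i\<in>Obj J. l i \<in> Hom C c (fobj D i)) \<and>
     (\<forall>i\<in>Obj J. \<forall>j\<in>Obj J. \<forall>u\<in>Hom J i j.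
        Comp C c (fobj D i) (fobj D j) (farr D i j u) (l i) = l j)"

definition is_limit ::
    "('i, 'a, 'y) cat_scheme \<Rightarrow> ('o, 'm, 'z) cat_scheme \<Rightarrow> ('i, 'a, 'o, 'm) ftor \<Rightarrow>
     'o \<Rightarrow> ('i \<Rightarrow> 'm) \<Rightarrow> bool" where
  "is_limit J C D c l \<longleftrightarrow>
     is_cone J C D c l \<and>
     (\<forall>c' l'. is_cone J C D c' l' \<longrightarrow>
        (\<exists>!h. h \<in> Hom C c' c \<and> (\<forall>i\<in>Obj J. Comp C c' c (fobj D i) (l i) h = l' i)))"

text \<open>Objects embed into arrows via identities, so bounding the arrows bounds the objects too.\<close>

definition small_category :: "('u, 'u) cat \<Rightarrow> bool" where
  "small_category J \<longleftrightarrow> category J \<and> small TYPE('u) (arrows J)"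

definition filtered :: "'u rel \<Rightarrow> ('u, 'u) cat \<Rightarrow> bool" where
  "filtered \<alpha> J \<longleftrightarrow>
     (\<forall>(I :: ('u, 'u) cat) D. category I \<and> |arrows I| <o \<alpha> \<and> cat_functor I J D
        \<longrightarrow> (\<exists>c l. is_cocone I J D c l))"

definition cocomplete :: "('o, 'u, 'z) cat_scheme \<Rightarrow> bool" where
  "cocomplete C \<longleftrightarrow>
     (\<forall>(J :: ('u, 'u) cat) D. small_category J \<and> cat_functor J C D
        \<longrightarrow> (\<exists>c l. is_colimit J C D c l))"

definition continuous ::
    "('o, 'u, 'y) cat_scheme \<Rightarrow> ('p, 'u, 'z) cat_scheme \<Rightarrow> ('o, 'u, 'p, 'u) ftor \<Rightarrow> bool" where
  "continuous C E F \<longleftrightarrow>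
     (\<forall>(J :: ('u, 'u) cat) D c l.
        small_category J \<and> cat_functor J C D \<and> is_limit J C D c l
        \<longrightarrow> is_limit J E (comp_ftor F D) (fobj F c)
              (\<lambda>i. farr F c (fobj D i) (l i)))"


section \<open>Linear categories\<close>

record ('k, 'o, 'm) lincat = "('o, 'm) cat" +
  hzero :: "'o \<Rightarrow> 'o \<Rightarrow> 'm"
  hadd :: "'o \<Rightarrow> 'o \<Rightarrow> 'm \<Rightarrow> 'm \<Rightarrow> 'm"
  hsmult :: "'o \<Rightarrow> 'o \<Rightarrow> 'k \<Rightarrow> 'm \<Rightarrow> 'm"

text \<open>Module records extend ring records, but \<^locale>\<open>module\<close> does not refer to their
  multiplicative part.\<close>

definition hom_module :: "('k, 'o, 'm) lincat \<Rightarrow> 'o \<Rightarrow> 'o \<Rightarrow> ('k, 'm) module" where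
  "hom_module C X Y =
     \<lparr>carrier = Hom C X Y, mult = undefined, one = undefined,
      zero = hzero C X Y, add = hadd C X Y, smult = hsmult C X Y\<rparr>"

definition mod_hom :: "'k ring \<Rightarrow> ('k, 'm) module \<Rightarrow> ('k, 'n) module \<Rightarrow> ('m \<Rightarrow> 'n) set" where
  "mod_hom R M N =
     {f \<in> carrier M \<rightarrow> carrier N.
        (\<forall>x\<in>carrier M. \<forall>y\<in>carrier M. f (x \<oplus>\<^bsub>M\<^esub> y) = f x \<oplus>\<^bsub>N\<^esub> f y) \<and>
        (\<forall>a\<in>carrier R. \<forall>x\<in>carrier M. f (a \<odot>\<^bsub>M\<^esub> x) = a \<odot>\<^bsub>N\<^esub> f x)}"

locale lin_category = category C
  for R :: "'k ring" and C :: "('k, 'o, 'm) lincat" +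
  assumes hom_module: "\<lbrakk>X \<in> Obj C; Y \<in> Obj C\<rbrakk> \<Longrightarrow> module R (hom_module C X Y)"
    and Comp_linear_right:
      "\<lbrakk>X \<in> Obj C; Y \<in> Obj C; Z \<in> Obj C; g \<in> Hom C Y Z\<rbrakk>
        \<Longrightarrow> (\<lambda>f. Comp C X Y Z g f) \<in> mod_hom R (hom_module C X Y) (hom_module C X Z)"
    and Comp_linear_left:
      "\<lbrakk>X \<in> Obj C; Y \<in> Obj C; Z \<in> Obj C; f \<in> Hom C X Y\<rbrakk>
        \<Longrightarrow> (\<lambda>g. Comp C X Y Z g f) \<in> mod_hom R (hom_module C Y Z) (hom_module C X Z)"

locale lin_functor = cat_functor C D F + dom: lin_category R C + cod: lin_category R D
  for R :: "'k ring" and C :: "('k, 'o, 'm) lincat" and D :: "('k, 'p, 'n) lincat"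
    and F :: "('o, 'm, 'p, 'n) ftor" +
  assumes farr_linear:
    "\<lbrakk>X \<in> Obj C; Y \<in> Obj C\<rbrakk>
      \<Longrightarrow> farr F X Y \<in> mod_hom R (hom_module C X Y) (hom_module D (fobj F X) (fobj F Y))"

definition lin_equivalent :: "'k ring \<Rightarrow> ('k, 'o, 'm) lincat \<Rightarrow> ('k, 'p, 'n) lincat \<Rightarrow> bool" where
  "lin_equivalent R C D \<longleftrightarrow>
     (\<exists>F G \<eta> \<epsilon>. lin_functor R C D F \<and> lin_functor R D C G \<and>
        nat_iso C C id_ftor (comp_ftor G F) \<eta> \<and> nat_iso D D (comp_ftor F G) id_ftor \<epsilon>)"

definition op_cat :: "('k, 'o, 'm) lincat \<Rightarrow> ('k, 'o, 'm) lincat" where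
  "op_cat C =
     \<lparr>Obj = Obj C,
      Hom = (\<lambda>X Y. Hom C Y X),
      Ident = Ident C,
      Comp = (\<lambda>X Y Z g f. Comp C Z Y X f g),
      hzero = (\<lambda>X Y. hzero C Y X),
      hadd = (\<lambda>X Y. hadd C Y X),
      hsmult = (\<lambda>X Y. hsmult C Y X)\<rparr>"


section \<open>Locally presentable linear categories\<close>

definition Mod :: "'k ring \<Rightarrow> (('k, 'u) module, 'u \<Rightarrow> 'u) cat" where
  "Mod R =
     \<lparr>Obj = {M. module R M \<and> small TYPE('u) (carrier M)},
      Hom = (\<lambda>M N. mod_hom R M N \<inter> extensional (carrier M)),
      Ident = (\<lambda>M. \<lambda>x\<in>carrier M. x),
      Comp = (\<lambda>M N P g f. compose (carrier M) g f)\<rparr>"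

definition hom_ftor ::
    "('k, 'o, 'u) lincat \<Rightarrow> 'o \<Rightarrow> ('o, 'u, ('k, 'u) module, 'u \<Rightarrow> 'u) ftor" where
  "hom_ftor C X =
     \<lparr>fobj = (\<lambda>Y. hom_module C X Y),
      farr = (\<lambda>Y Z g. \<lambda>f\<in>Hom C X Y. Comp C X Y Z g f)\<rparr>"

definition presentable :: "'k ring \<Rightarrow> 'u rel \<Rightarrow> ('k, 'o, 'u) lincat \<Rightarrow> 'o \<Rightarrow> bool" where
  "presentable R \<alpha> C X \<longleftrightarrow>
     X \<in> Obj C \<and>
     (\<forall>J D c l.
        small_category J \<and> filtered \<alpha> J \<and> cat_functor J C D \<and> is_colimit J C D c l
        \<longrightarrow> is_colimit J (Mod R) (comp_ftor (hom_ftor C X) D) (fobj (hom_ftor C X) c)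
              (\<lambda>i. farr (hom_ftor C X) (fobj D i) c (l i)))"

text \<open>The first two conjuncts say that \<open>C\<close> is a linear category relative to the universe.\<close>

definition locally_presentable_at :: "'k ring \<Rightarrow> 'u rel \<Rightarrow> ('k, 'o, 'u) lincat \<Rightarrow> bool" where
  "locally_presentable_at R \<alpha> C \<longleftrightarrow>
     lin_category R C \<and>
     (\<forall>X\<in>Obj C. \<forall>Y\<in>Obj C. small TYPE('u) (Hom C X Y)) \<and>
     cocomplete C \<and>
     (\<exists>G. small TYPE('u) G \<and> (\<forall>X\<in>G. presentable R \<alpha> C X) \<and>
        (\<forall>X\<in>Obj C. \<exists>J D l. small_category J \<and> filtered \<alpha> J \<and> cat_functor J C D \<and>
           (\<forall>i\<in>Obj J. fobj D i \<in> G) \<and> is_colimit J C D X l))"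

definition locally_presentable :: "'k ring \<Rightarrow> ('k, 'o, 'u) lincat \<Rightarrow> bool" where
  "locally_presentable R C \<longleftrightarrow>
     (\<exists>\<alpha> :: 'u rel. small_regular_cardinal \<alpha> \<and> locally_presentable_at R \<alpha> C)"


section \<open>The tensor product\<close>

definition Cont ::
    "'k ring \<Rightarrow> ('k, 'o, 'u) lincat \<Rightarrow> ('k, 'p, 'u) lincat \<Rightarrow>
     ('k, ('o, 'u, 'p, 'u) ftor, 'o \<Rightarrow> 'u) lincat" where
  "Cont R C D =
     \<lparr>Obj = {F. lin_functor R C D F \<and> continuous C D F \<and> ftor_extensional C F},
      Hom = (\<lambda>F G. {t \<in> extensional (Obj C). nat_trans C D F G t}),
      Ident = (\<lambda>F. \<lambda>X\<in>Obj C. Ident D (fobj F X)),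
      Comp = (\<lambda>F G H s t. \<lambda>X\<in>Obj C. Comp D (fobj F X) (fobj G X) (fobj H X) (s X) (t X)),
      hzero = (\<lambda>F G. \<lambda>X\<in>Obj C. hzero D (fobj F X) (fobj G X)),
      hadd = (\<lambda>F G s t. \<lambda>X\<in>Obj C. hadd D (fobj F X) (fobj G X) (s X) (t X)),
      hsmult = (\<lambda>F G a t. \<lambda>X\<in>Obj C. hsmult D (fobj F X) (fobj G X) a (t X))\<rparr>"

definition LP_tensor ::
    "'k ring \<Rightarrow> ('k, 'a, 'u) lincat \<Rightarrow> ('k, 'b, 'u) lincat \<Rightarrow>
     ('k, ('a, 'u, 'b, 'u) ftor, 'a \<Rightarrow> 'u) lincat" where
  "LP_tensor R A B = Cont R (op_cat A) B"

end

theory Submission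
  imports Defs
begin

text \<open>
  A continuous functor \<open>F : A\<^sup>o\<^sup>p \<rightarrow> B\<close> has a mutual right adjoint \<open>G : B\<^sup>o\<^sup>p \<rightarrow> A\<close>, that is,
  \<open>B(Y, F X) \<cong> A(X, G Y)\<close> naturally in \<open>X\<close> and \<open>Y\<close>; in this relation \<open>F\<close> and \<open>G\<close> play symmetric
  roles, and \<open>G\<close> is again continuous. To find \<open>G Y\<close>, one needs a terminal object in the category
  of elements of \<open>B(Y, F -)\<close>. That category inherits colimits from \<open>A\<close>, since \<open>F\<close> turns colimits
  of \<open>A\<close> into limits, and its elements over the generators of \<open>A\<close> have a weakly terminal
  colimit because every object of \<open>A\<close> is a colimit of generators; the coequalizer of the endomorphisms
  of a weakly terminal object is terminal. Choosing adjoints defines functors in both directions: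
  a transformation \<open>F \<rightarrow> F'\<close> is sent to its mate \<open>G \<rightarrow> G'\<close>. Passing to mates is functorial, linear
  and involutive, so the mates of identities compare two adjoints of the same functor
  and show that these functors are mutually inverse.
\<close>

section \<open>Linear categories of continuous functors\<close>

context lin_category
begin

lemma Comp_hadd_right:
  assumes "X \<in> Obj C" "Y \<in> Obj C" "Z \<in> Obj C" "f \<in> Hom C X Y" "f' \<in> Hom C X Y" "g \<in> Hom C Y Z"
  shows "Comp C X Y Z g (hadd C X Y f f') = hadd C X Z (Comp C X Y Z g f) (Comp C X Y Z g f')"
  using Comp_linear_right[of X Y Z g] assms by (simp add: mod_hom_def hom_module_def)

lemma Comp_hadd_left:
  assumes "X \<in> Obj C" "Y \<in> Obj C" "Z \<in> Obj C" "f \<in> Hom C X Y" "g \<in> Hom C Y Z" "g' \<in> Hom C Y Z"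
  shows "Comp C X Y Z (hadd C Y Z g g') f = hadd C X Z (Comp C X Y Z g f) (Comp C X Y Z g' f)"
  using Comp_linear_left[of X Y Z f] assms by (simp add: mod_hom_def hom_module_def)

lemma Comp_hsmult_right:
  assumes "X \<in> Obj C" "Y \<in> Obj C" "Z \<in> Obj C" "a \<in> carrier R" "f \<in> Hom C X Y" "g \<in> Hom C Y Z"
  shows "Comp C X Y Z g (hsmult C X Y a f) = hsmult C X Z a (Comp C X Y Z g f)"
  using Comp_linear_right[of X Y Z g] assms by (simp add: mod_hom_def hom_module_def)

lemma Comp_hsmult_left:
  assumes "X \<in> Obj C" "Y \<in> Obj C" "Z \<in> Obj C" "a \<in> carrier R" "f \<in> Hom C X Y" "g \<in> Hom C Y Z"
  shows "Comp C X Y Z (hsmult C Y Z a g) f = hsmult C X Z a (Comp C X Y Z g f)"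
  using Comp_linear_left[of X Y Z f] assms by (simp add: mod_hom_def hom_module_def)

text \<open>These are the module laws read off from \<open>hom_module\<close>. The record has no
  negation, so the additive inverse appears in \<open>hadd_uminus\<close> as the scalar multiple by
  minus one.\<close>

lemma
  assumes "X \<in> Obj C" "Y \<in> Obj C"
  shows hzero_closed: "hzero C X Y \<in> Hom C X Y"
    and hadd_closed: "\<And>f g. \<lbrakk>f \<in> Hom C X Y; g \<in> Hom C X Y\<rbrakk> \<Longrightarrow> hadd C X Y f g \<in> Hom C X Y"
    and hsmult_closed: "\<And>a f. \<lbrakk>a \<in> carrier R; f \<in> Hom C X Y\<rbrakk> \<Longrightarrow> hsmult C X Y a f \<in> Hom C X Y"
    and hadd_assoc: "\<And>f g h. \<lbrakk>f \<in> Hom C X Y; g \<in> Hom C X Y; h \<in> Hom C X Y\<rbrakk>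
      \<Longrightarrow> hadd C X Y (hadd C X Y f g) h = hadd C X Y f (hadd C X Y g h)"
    and hadd_commute: "\<And>f g. \<lbrakk>f \<in> Hom C X Y; g \<in> Hom C X Y\<rbrakk> \<Longrightarrow> hadd C X Y f g = hadd C X Y g f"
    and hadd_hzero: "\<And>f. f \<in> Hom C X Y \<Longrightarrow> hadd C X Y (hzero C X Y) f = f"
    and hsmult_zero: "\<And>f. f \<in> Hom C X Y \<Longrightarrow> hsmult C X Y \<zero>\<^bsub>R\<^esub> f = hzero C X Y"
    and hadd_uminus: "\<And>f. f \<in> Hom C X Y
      \<Longrightarrow> hadd C X Y (hsmult C X Y (\<ominus>\<^bsub>R\<^esub> \<one>\<^bsub>R\<^esub>) f) f = hzero C X Y"
    and hsmult_add: "\<And>a b f. \<lbrakk>a \<in> carrier R; b \<in> carrier R; f \<in> Hom C X Y\<rbrakk>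
      \<Longrightarrow> hsmult C X Y (a \<oplus>\<^bsub>R\<^esub> b) f = hadd C X Y (hsmult C X Y a f) (hsmult C X Y b f)"
    and hsmult_hadd: "\<And>a f g. \<lbrakk>a \<in> carrier R; f \<in> Hom C X Y; g \<in> Hom C X Y\<rbrakk>
      \<Longrightarrow> hsmult C X Y a (hadd C X Y f g) = hadd C X Y (hsmult C X Y a f) (hsmult C X Y a g)"
    and hsmult_hsmult: "\<And>a b f. \<lbrakk>a \<in> carrier R; b \<in> carrier R; f \<in> Hom C X Y\<rbrakk>
      \<Longrightarrow> hsmult C X Y (a \<otimes>\<^bsub>R\<^esub> b) f = hsmult C X Y a (hsmult C X Y b f)"
    and hsmult_one: "\<And>f. f \<in> Hom C X Y \<Longrightarrow> hsmult C X Y \<one>\<^bsub>R\<^esub> f = f"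
proof -
  interpret M: module R "hom_module C X Y" by (rule hom_module[OF assms])
  note [simp] = hom_module_def
  show "hzero C X Y \<in> Hom C X Y" using M.M.zero_closed by simp
  show "hadd C X Y f g \<in> Hom C X Y" if "f \<in> Hom C X Y" "g \<in> Hom C X Y" for f g
    using M.M.add.m_closed[of f g] that by simp
  show "hsmult C X Y a f \<in> Hom C X Y" if "a \<in> carrier R" "f \<in> Hom C X Y" for a f
    using M.smult_closed[of a f] that by simp
  show "hadd C X Y (hadd C X Y f g) h = hadd C X Y f (hadd C X Y g h)"
    if "f \<in> Hom C X Y" "g \<in> Hom C X Y" "h \<in> Hom C X Y" for f g h
    using M.M.add.m_assoc[of f g h] that by simp
  show "hadd C X Y f g = hadd C X Y g f" if "f \<in> Hom C X Y" "g \<in> Hom C X Y" for f g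
    using M.M.add.m_comm[of f g] that by simp
  show "hadd C X Y (hzero C X Y) f = f" if "f \<in> Hom C X Y" for f
    using M.M.add.l_one[of f] that by simp
  show "hsmult C X Y \<zero>\<^bsub>R\<^esub> f = hzero C X Y" if "f \<in> Hom C X Y" for f
    using M.smult_l_null[of f] that by simp
  show "hsmult C X Y (a \<oplus>\<^bsub>R\<^esub> b) f = hadd C X Y (hsmult C X Y a f) (hsmult C X Y b f)"
    if "a \<in> carrier R" "b \<in> carrier R" "f \<in> Hom C X Y" for a b f
    using M.smult_l_distr[of a b f] that by simp
  show "hsmult C X Y a (hadd C X Y f g) = hadd C X Y (hsmult C X Y a f) (hsmult C X Y a g)"
    if "a \<in> carrier R" "f \<in> Hom C X Y" "g \<in> Hom C X Y" for a f g
    using M.smult_r_distr[of a f g] that by simp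
  show "hsmult C X Y (a \<otimes>\<^bsub>R\<^esub> b) f = hsmult C X Y a (hsmult C X Y b f)"
    if "a \<in> carrier R" "b \<in> carrier R" "f \<in> Hom C X Y" for a b f
    using M.smult_assoc1[of a b f] that by simp
  show one: "hsmult C X Y \<one>\<^bsub>R\<^esub> f = f" if "f \<in> Hom C X Y" for f
    using M.smult_one[of f] that by simp
  show "hadd C X Y (hsmult C X Y (\<ominus>\<^bsub>R\<^esub> \<one>\<^bsub>R\<^esub>) f) f = hzero C X Y" if "f \<in> Hom C X Y" for f
    using M.smult_l_distr[of "\<ominus>\<^bsub>R\<^esub> \<one>\<^bsub>R\<^esub>" "\<one>\<^bsub>R\<^esub>" f] M.smult_l_null[of f] that one[of f]
    by (simp add: M.R.l_neg)
qed

text \<open>Preservation of zero is not part of \<open>mod_hom\<close>. It follows from scalar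
  linearity, because the zero morphism is its own multiple by the scalar zero.\<close>

lemma
  assumes "X \<in> Obj C" "Y \<in> Obj C" "Z \<in> Obj C"
  shows Comp_hzero_right: "g \<in> Hom C Y Z \<Longrightarrow> Comp C X Y Z g (hzero C X Y) = hzero C X Z"
    and Comp_hzero_left: "f \<in> Hom C X Y \<Longrightarrow> Comp C X Y Z (hzero C Y Z) f = hzero C X Z"
proof -
  interpret M: module R "hom_module C X Y" by (rule hom_module) fact+
  show "Comp C X Y Z g (hzero C X Y) = hzero C X Z" if "g \<in> Hom C Y Z"
    using assms that Comp_hsmult_right[of X Y Z "\<zero>\<^bsub>R\<^esub>" "hzero C X Y" g]
    by (simp add: hsmult_zero hzero_closed Comp_closed)
  show "Comp C X Y Z (hzero C Y Z) f = hzero C X Z" if "f \<in> Hom C X Y"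
    using assms that Comp_hsmult_left[of X Y Z "\<zero>\<^bsub>R\<^esub>" f "hzero C Y Z"]
    by (simp add: hsmult_zero hzero_closed Comp_closed)
qed

end

lemma mod_hom_hom_moduleI:
  assumes "\<And>f. f \<in> Hom C X Y \<Longrightarrow> H f \<in> Hom D U V"
    and "\<And>f g. \<lbrakk>f \<in> Hom C X Y; g \<in> Hom C X Y\<rbrakk> \<Longrightarrow> H (hadd C X Y f g) = hadd D U V (H f) (H g)"
    and "\<And>a f. \<lbrakk>a \<in> carrier R; f \<in> Hom C X Y\<rbrakk> \<Longrightarrow> H (hsmult C X Y a f) = hsmult D U V a (H f)"
  shows "H \<in> mod_hom R (hom_module C X Y) (hom_module D U V)"
  using assms by (auto simp: mod_hom_def hom_module_def)

lemma (in lin_functor)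
  assumes "X \<in> Obj C" "Y \<in> Obj C"
  shows farr_hadd: "\<And>f g. \<lbrakk>f \<in> Hom C X Y; g \<in> Hom C X Y\<rbrakk>
      \<Longrightarrow> farr F X Y (hadd C X Y f g) = hadd D (fobj F X) (fobj F Y) (farr F X Y f) (farr F X Y g)"
    and farr_hsmult: "\<And>a f. \<lbrakk>a \<in> carrier R; f \<in> Hom C X Y\<rbrakk>
      \<Longrightarrow> farr F X Y (hsmult C X Y a f) = hsmult D (fobj F X) (fobj F Y) a (farr F X Y f)"
  using farr_linear[OF assms] by (auto simp: mod_hom_def hom_module_def)

section \<open>Opposite linear categories\<close>

lemma op_cat_simps [simp]:
  "Obj (op_cat C) = Obj C" "Hom (op_cat C) X Y = Hom C Y X" "Ident (op_cat C) = Ident C"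
  "Comp (op_cat C) X Y Z g f = Comp C Z Y X f g" "hzero (op_cat C) X Y = hzero C Y X"
  "hadd (op_cat C) X Y = hadd C Y X" "hsmult (op_cat C) X Y = hsmult C Y X"
  by (simp_all add: op_cat_def)

lemma hom_module_op_cat [simp]: "hom_module (op_cat C) X Y = hom_module C Y X"
  by (simp add: hom_module_def)

lemma lin_category_op_cat:
  assumes "lin_category R C"
  shows "lin_category R (op_cat C)"
proof -
  interpret lin_category R C by fact
  show ?thesis
    by (intro lin_category.intro category.intro lin_category_axioms.intro)
      (simp_all add: Ident_closed Comp_closed Comp_Ident_left Comp_Ident_right Comp_assoc
        hom_module Comp_linear_left Comp_linear_right)
qed

section \<open>Natural transformations and the linear category of continuous functors\<close>

lemma nat_transI:
  assumes "\<And>X. X \<in> Obj C \<Longrightarrow> t X \<in> Hom D (fobj F X) (fobj G X)"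
    and "\<And>X Y f. \<lbrakk>X \<in> Obj C; Y \<in> Obj C; f \<in> Hom C X Y\<rbrakk>
      \<Longrightarrow> Comp D (fobj F X) (fobj F Y) (fobj G Y) (t Y) (farr F X Y f)
        = Comp D (fobj F X) (fobj G X) (fobj G Y) (farr G X Y f) (t X)"
  shows "nat_trans C D F G t"
  using assms by (simp add: nat_trans_def)

lemma nat_transD:
  assumes "nat_trans C D F G t"
  shows "X \<in> Obj C \<Longrightarrow> t X \<in> Hom D (fobj F X) (fobj G X)"
    and "\<lbrakk>X \<in> Obj C; Y \<in> Obj C; f \<in> Hom C X Y\<rbrakk>
      \<Longrightarrow> Comp D (fobj F X) (fobj F Y) (fobj G Y) (t Y) (farr F X Y f)
        = Comp D (fobj F X) (fobj G X) (fobj G Y) (farr G X Y f) (t X)"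
  using assms by (simp_all add: nat_trans_def)

lemma Cont_simps:
  "F \<in> Obj (Cont R C D) \<longleftrightarrow> lin_functor R C D F \<and> continuous C D F \<and> ftor_extensional C F"
  "t \<in> Hom (Cont R C D) F G \<longleftrightarrow> t \<in> extensional (Obj C) \<and> nat_trans C D F G t"
  "Ident (Cont R C D) F = (\<lambda>X\<in>Obj C. Ident D (fobj F X))"
  "Comp (Cont R C D) F G H s t =
    (\<lambda>X\<in>Obj C. Comp D (fobj F X) (fobj G X) (fobj H X) (s X) (t X))"
  "hzero (Cont R C D) F G = (\<lambda>X\<in>Obj C. hzero D (fobj F X) (fobj G X))"
  "hadd (Cont R C D) F G s t = (\<lambda>X\<in>Obj C. hadd D (fobj F X) (fobj G X) (s X) (t X))"
  "hsmult (Cont R C D) F G a t = (\<lambda>X\<in>Obj C. hsmult D (fobj F X) (fobj G X) a (t X))"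
  by (simp_all add: Cont_def)

text \<open>Naturality passes to the pointwise operations: for composites the two naturality squares
  are pasted, for sums and multiples composition in \<open>D\<close> is bilinear.\<close>

lemma Cont_nat_trans_closed:
  assumes "F \<in> Obj (Cont R C D)" "G \<in> Obj (Cont R C D)"
  shows "nat_trans C D F F (\<lambda>X\<in>Obj C. Ident D (fobj F X))"
    and "\<And>H s t. \<lbrakk>H \<in> Obj (Cont R C D); nat_trans C D F G t; nat_trans C D G H s\<rbrakk>
      \<Longrightarrow> nat_trans C D F H (\<lambda>X\<in>Obj C. Comp D (fobj F X) (fobj G X) (fobj H X) (s X) (t X))"
    and "nat_trans C D F G (\<lambda>X\<in>Obj C. hzero D (fobj F X) (fobj G X))"
    and "\<And>s t. \<lbrakk>nat_trans C D F G s; nat_trans C D F G t\<rbrakk>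
      \<Longrightarrow> nat_trans C D F G (\<lambda>X\<in>Obj C. hadd D (fobj F X) (fobj G X) (s X) (t X))"
    and "\<And>a t. \<lbrakk>a \<in> carrier R; nat_trans C D F G t\<rbrakk>
      \<Longrightarrow> nat_trans C D F G (\<lambda>X\<in>Obj C. hsmult D (fobj F X) (fobj G X) a (t X))"
proof -
  interpret F: lin_functor R C D F using assms by (simp add: Cont_simps)
  interpret G: lin_functor R C D G using assms by (simp add: Cont_simps)
  note obj = F.fobj_closed G.fobj_closed
  note arr = F.farr_closed G.farr_closed
  show "nat_trans C D F F (\<lambda>X\<in>Obj C. Ident D (fobj F X))"
    by (rule nat_transI)
      (simp_all add: obj arr F.cod.Ident_closed F.cod.Comp_Ident_left F.cod.Comp_Ident_right)
  show "nat_trans C D F H (\<lambda>X\<in>Obj C. Comp D (fobj F X) (fobj G X) (fobj H X) (s X) (t X))"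
    if H: "H \<in> Obj (Cont R C D)" and t: "nat_trans C D F G t" and s: "nat_trans C D G H s" for H s t
  proof -
    interpret H: lin_functor R C D H using H by (simp add: Cont_simps)
    note [simp] = obj arr H.fobj_closed H.farr_closed nat_transD(1)[OF t] nat_transD(1)[OF s]
    show ?thesis
    proof (rule nat_transI, simp_all add: F.cod.Comp_closed)
      fix X Y f assume X [simp]: "X \<in> Obj C" and Y [simp]: "Y \<in> Obj C" and f [simp]: "f \<in> Hom C X Y"
      have "Comp D (fobj F X) (fobj F Y) (fobj H Y) (Comp D (fobj F Y) (fobj G Y) (fobj H Y) (s Y) (t Y)) (farr F X Y f)
        = Comp D (fobj F X) (fobj G Y) (fobj H Y) (s Y)
            (Comp D (fobj F X) (fobj F Y) (fobj G Y) (t Y) (farr F X Y f))"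
        by (rule F.cod.Comp_assoc[symmetric]) simp_all
      also have "\<dots> = Comp D (fobj F X) (fobj G Y) (fobj H Y) (s Y)
            (Comp D (fobj F X) (fobj G X) (fobj G Y) (farr G X Y f) (t X))"
        by (simp add: nat_transD(2)[OF t])
      also have "\<dots> = Comp D (fobj F X) (fobj G X) (fobj H Y)
            (Comp D (fobj G X) (fobj G Y) (fobj H Y) (s Y) (farr G X Y f)) (t X)"
        by (rule F.cod.Comp_assoc) simp_all
      also have "\<dots> = Comp D (fobj F X) (fobj G X) (fobj H Y)
            (Comp D (fobj G X) (fobj H X) (fobj H Y) (farr H X Y f) (s X)) (t X)"
        by (simp add: nat_transD(2)[OF s])
      also have "\<dots> = Comp D (fobj F X) (fobj H X) (fobj H Y) (farr H X Y f)
            (Comp D (fobj F X) (fobj G X) (fobj H X) (s X) (t X))"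
        by (rule F.cod.Comp_assoc[symmetric]) simp_all
      finally show "Comp D (fobj F X) (fobj F Y) (fobj H Y) (Comp D (fobj F Y) (fobj G Y) (fobj H Y) (s Y) (t Y)) (farr F X Y f)
        = Comp D (fobj F X) (fobj H X) (fobj H Y) (farr H X Y f)
            (Comp D (fobj F X) (fobj G X) (fobj H X) (s X) (t X))" .
    qed
  qed
  show "nat_trans C D F G (\<lambda>X\<in>Obj C. hzero D (fobj F X) (fobj G X))"
    by (rule nat_transI) (simp_all add: obj arr F.cod.hzero_closed F.cod.Comp_hzero_left F.cod.Comp_hzero_right)
  show "nat_trans C D F G (\<lambda>X\<in>Obj C. hadd D (fobj F X) (fobj G X) (s X) (t X))"
    if s: "nat_trans C D F G s" and t: "nat_trans C D F G t" for s t
    by (rule nat_transI)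
      (simp_all add: obj arr F.cod.hadd_closed nat_transD(1)[OF s] nat_transD(1)[OF t]
        F.cod.Comp_hadd_left F.cod.Comp_hadd_right nat_transD(2)[OF s] nat_transD(2)[OF t])
  show "nat_trans C D F G (\<lambda>X\<in>Obj C. hsmult D (fobj F X) (fobj G X) a (t X))"
    if "a \<in> carrier R" and t: "nat_trans C D F G t" for a t
    by (rule nat_transI)
      (simp_all add: obj arr that(1) F.cod.hsmult_closed nat_transD(1)[OF t]
        F.cod.Comp_hsmult_left F.cod.Comp_hsmult_right nat_transD(2)[OF t])
qed

text \<open>Every axiom is checked pointwise in \<open>D\<close>, and extensionality turns agreement
  on \<open>Obj C\<close> into equality. The hypothesis \<open>cring R\<close> is separate because,
  if \<open>C\<close> and \<open>D\<close> have no objects, the empty functor is still an object and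
  its endomorphism module needs the ring axioms.\<close>

lemma lin_category_Cont:
  assumes C: "lin_category R C" and D: "lin_category R D" and R: "cring R"
  shows "lin_category R (Cont R C D)"
proof -
  interpret D: lin_category R D by fact
  interpret R: cring R by fact
  have obj: "fobj F X \<in> Obj D" if "F \<in> Obj (Cont R C D)" "X \<in> Obj C" for F X
    using that lin_functor.axioms(1) cat_functor.fobj_closed by (fastforce simp: Cont_simps)
  have mod: "module R (hom_module (Cont R C D) F G)"
    if F: "F \<in> Obj (Cont R C D)" and G: "G \<in> Obj (Cont R C D)" for F G
  proof (rule moduleI[OF R])
    note cl = Cont_nat_trans_closed[OF F G]
    note o = obj[OF F] obj[OF G]
    show "abelian_group (hom_module (Cont R C D) F G)"
    proof (rule abelian_groupI, simp_all add: hom_module_def Cont_simps cl)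
      fix s t r assume s: "s \<in> extensional (Obj C) \<and> nat_trans C D F G s"
        and t: "t \<in> extensional (Obj C) \<and> nat_trans C D F G t"
      note m = nat_transD(1)[OF conjunct2[OF s]] nat_transD(1)[OF conjunct2[OF t]]
      show "(\<lambda>X\<in>Obj C. hadd D (fobj F X) (fobj G X) (s X) (t X)) =
        (\<lambda>X\<in>Obj C. hadd D (fobj F X) (fobj G X) (t X) (s X))"
        by (intro restrict_ext) (simp add: o m D.hadd_commute)
      assume r: "r \<in> extensional (Obj C) \<and> nat_trans C D F G r"
      note m = m nat_transD(1)[OF conjunct2[OF r]]
      show "(\<lambda>X\<in>Obj C. hadd D (fobj F X) (fobj G X)
          (if X \<in> Obj C then hadd D (fobj F X) (fobj G X) (s X) (t X) else undefined) (r X)) =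
        (\<lambda>X\<in>Obj C. hadd D (fobj F X) (fobj G X) (s X)
          (if X \<in> Obj C then hadd D (fobj F X) (fobj G X) (t X) (r X) else undefined))"
        by (intro restrict_ext) (simp add: o m D.hadd_assoc)
    next
      fix s assume s: "s \<in> extensional (Obj C) \<and> nat_trans C D F G s"
      note m = nat_transD(1)[OF conjunct2[OF s]]
      show "(\<lambda>X\<in>Obj C. hadd D (fobj F X) (fobj G X)
          (if X \<in> Obj C then hzero D (fobj F X) (fobj G X) else undefined) (s X)) = s"
        by (rule extensionalityI[of _ "Obj C"]) (simp_all add: o m s D.hadd_hzero)
      show "\<exists>t\<in>Hom (Cont R C D) F G.
         (\<lambda>X\<in>Obj C. hadd D (fobj F X) (fobj G X) (t X) (s X)) =
         (\<lambda>X\<in>Obj C. hzero D (fobj F X) (fobj G X))"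
        by (rule bexI[of _ "\<lambda>X\<in>Obj C. hsmult D (fobj F X) (fobj G X) (\<ominus>\<^bsub>R\<^esub> \<one>\<^bsub>R\<^esub>) (s X)"])
          (use s in \<open>auto simp: o m D.hadd_uminus cl Cont_simps intro!: restrict_ext\<close>)
    qed
  next
    fix a b t assume "a \<in> carrier R" "b \<in> carrier R" "t \<in> carrier (hom_module (Cont R C D) F G)"
    then have "t \<in> extensional (Obj C)" and t: "nat_trans C D F G t" and "a \<in> carrier R" "b \<in> carrier R"
      by (simp_all add: hom_module_def Cont_simps)
    note m = this(3,4) nat_transD(1)[OF t]
    note [simp] = hom_module_def Cont_simps obj[OF F] obj[OF G] m
    show "(a \<oplus>\<^bsub>R\<^esub> b) \<odot>\<^bsub>hom_module (Cont R C D) F G\<^esub> t =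
       a \<odot>\<^bsub>hom_module (Cont R C D) F G\<^esub> t \<oplus>\<^bsub>hom_module (Cont R C D) F G\<^esub>
       b \<odot>\<^bsub>hom_module (Cont R C D) F G\<^esub> t"
      by (auto simp: D.hsmult_add intro!: restrict_ext)
    show "(a \<otimes>\<^bsub>R\<^esub> b) \<odot>\<^bsub>hom_module (Cont R C D) F G\<^esub> t =
       a \<odot>\<^bsub>hom_module (Cont R C D) F G\<^esub> (b \<odot>\<^bsub>hom_module (Cont R C D) F G\<^esub> t)"
      by (auto simp: D.hsmult_hsmult intro!: restrict_ext)
  next
    fix a t assume "a \<in> carrier R" "t \<in> carrier (hom_module (Cont R C D) F G)"
    then show "a \<odot>\<^bsub>hom_module (Cont R C D) F G\<^esub> t \<in> carrier (hom_module (Cont R C D) F G)"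
      by (simp add: hom_module_def Cont_simps Cont_nat_trans_closed[OF F G])
  next
    fix a s t assume "a \<in> carrier R" "s \<in> carrier (hom_module (Cont R C D) F G)"
      "t \<in> carrier (hom_module (Cont R C D) F G)"
    then have s: "nat_trans C D F G s" and t: "nat_trans C D F G t" and "a \<in> carrier R"
      by (simp_all add: hom_module_def Cont_simps)
    note m = this(3) nat_transD(1)[OF s] nat_transD(1)[OF t]
    show "a \<odot>\<^bsub>hom_module (Cont R C D) F G\<^esub> (s \<oplus>\<^bsub>hom_module (Cont R C D) F G\<^esub> t) =
       a \<odot>\<^bsub>hom_module (Cont R C D) F G\<^esub> s \<oplus>\<^bsub>hom_module (Cont R C D) F G\<^esub>
       a \<odot>\<^bsub>hom_module (Cont R C D) F G\<^esub> t"
      by (auto simp: hom_module_def Cont_simps obj[OF F] obj[OF G] m D.hsmult_hadd intro!: restrict_ext)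
  next
    fix t assume "t \<in> carrier (hom_module (Cont R C D) F G)"
    then have e: "t \<in> extensional (Obj C)" and t: "nat_trans C D F G t"
      by (simp_all add: hom_module_def Cont_simps)
    show "\<one>\<^bsub>R\<^esub> \<odot>\<^bsub>hom_module (Cont R C D) F G\<^esub> t = t"
      by (rule extensionalityI[OF _ e])
        (simp_all add: hom_module_def Cont_simps(7) obj[OF F] obj[OF G] nat_transD(1)[OF t] D.hsmult_one)
  qed
  have mem: "t X \<in> Hom D (fobj F X) (fobj G X)" if "t \<in> Hom (Cont R C D) F G" "X \<in> Obj C" for t F G X
    by (rule nat_transD(1)[OF _ that(2)]) (use that(1) in \<open>simp add: Cont_simps(2)\<close>)
  have ext: "t \<in> extensional (Obj C)" if "t \<in> Hom (Cont R C D) F G" for t F G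
    using that by (simp add: Cont_simps)
  have comp: "Comp (Cont R C D) F G H s t \<in> Hom (Cont R C D) F H"
    if "F \<in> Obj (Cont R C D)" "G \<in> Obj (Cont R C D)" "H \<in> Obj (Cont R C D)"
      "t \<in> Hom (Cont R C D) F G" "s \<in> Hom (Cont R C D) G H" for F G H s t
    using Cont_nat_trans_closed(2)[OF that(1-3)] that(4,5) by (simp add: Cont_simps(2,4))
  show ?thesis
  proof (intro lin_category.intro category.intro lin_category_axioms.intro)
    show "Ident (Cont R C D) F \<in> Hom (Cont R C D) F F" if "F \<in> Obj (Cont R C D)" for F
      using Cont_nat_trans_closed(1)[OF that that] by (simp add: Cont_simps)
    show "Comp (Cont R C D) F F G t (Ident (Cont R C D) F) = t"
      if "F \<in> Obj (Cont R C D)" "G \<in> Obj (Cont R C D)" "t \<in> Hom (Cont R C D) F G" for F G t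
      by (rule extensionalityI[OF _ ext[OF that(3)]])
        (simp_all add: Cont_simps(3,4) obj that mem[OF that(3)] D.Comp_Ident_right)
    show "Comp (Cont R C D) F G G (Ident (Cont R C D) G) t = t"
      if "F \<in> Obj (Cont R C D)" "G \<in> Obj (Cont R C D)" "t \<in> Hom (Cont R C D) F G" for F G t
      by (rule extensionalityI[OF _ ext[OF that(3)]])
        (simp_all add: Cont_simps(3,4) obj that mem[OF that(3)] D.Comp_Ident_left)
    show "Comp (Cont R C D) E G H s (Comp (Cont R C D) E F G t r)
        = Comp (Cont R C D) E F H (Comp (Cont R C D) F G H s t) r"
      if "E \<in> Obj (Cont R C D)" "F \<in> Obj (Cont R C D)" "G \<in> Obj (Cont R C D)" "H \<in> Obj (Cont R C D)"
        "r \<in> Hom (Cont R C D) E F" "t \<in> Hom (Cont R C D) F G" "s \<in> Hom (Cont R C D) G H"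
      for E F G H r s t
      unfolding Cont_simps(4)
      by (rule restrict_ext) (simp add: D.Comp_assoc obj that mem[OF that(5)] mem[OF that(6)] mem[OF that(7)])
    fix F G H assume O: "F \<in> Obj (Cont R C D)" "G \<in> Obj (Cont R C D)" "H \<in> Obj (Cont R C D)"
    show "(\<lambda>t. Comp (Cont R C D) F G H s t)
        \<in> mod_hom R (hom_module (Cont R C D) F G) (hom_module (Cont R C D) F H)"
      if "s \<in> Hom (Cont R C D) G H" for s
      by (rule mod_hom_hom_moduleI) (use O that in \<open>auto simp: comp[unfolded Cont_simps(4)] Cont_simps(4-) obj mem
            D.Comp_hadd_right D.Comp_hsmult_right intro!: restrict_ext\<close>)
    show "(\<lambda>s. Comp (Cont R C D) F G H s t)
        \<in> mod_hom R (hom_module (Cont R C D) G H) (hom_module (Cont R C D) F H)"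
      if "t \<in> Hom (Cont R C D) F G" for t
      by (rule mod_hom_hom_moduleI) (use O that in \<open>auto simp: comp[unfolded Cont_simps(4)] Cont_simps(4-) obj mem
            D.Comp_hadd_left D.Comp_hsmult_left intro!: restrict_ext\<close>)
  qed (simp_all add: comp mod)
qed


section \<open>Representability of continuous presheaves\<close>

lemma small_mono: "small TYPE('u) T \<Longrightarrow> S \<subseteq> T \<Longrightarrow> small TYPE('u) S"
  unfolding small_def using card_of_mono1 ordLeq_ordLess_trans by blast

lemma small_image: "small TYPE('u) S \<Longrightarrow> small TYPE('u) (f ` S)"
  unfolding small_def using card_of_image ordLeq_ordLess_trans by blast

lemma small_finite: "universe TYPE('u) \<Longrightarrow> finite S \<Longrightarrow> small TYPE('u) S"
  unfolding small_def universe_def finite_iff_ordLess_natLeq using ordLess_transitive by blast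

text \<open>This is regularity of the universe: an infinite regular cardinal is stable under sums of
  fewer sets of smaller size.\<close>

lemma small_Sigma:
  assumes U: "universe TYPE('u)" and "small TYPE('u) I" and "\<And>i. i \<in> I \<Longrightarrow> small TYPE('u) (S i)"
  shows "small TYPE('u) (SIGMA i:I. S i)"
proof -
  have inf: "infinite (UNIV :: 'u set)"
  proof
    assume "finite (UNIV :: 'u set)"
    then have "|UNIV :: 'u set| <o natLeq" by (simp add: finite_iff_ordLess_natLeq)
    then show False using U ordLess_transitive ordLess_irreflexive unfolding universe_def by blast
  qed
  have "stable |UNIV :: 'u set|"
    using U inf by (intro regularCard_stable) (auto simp: universe_def Field_card_of card_of_card_order_on)
  then show ?thesis using assms(2,3) unfolding small_def by (intro stable_elim) auto
qed

text \<open>Serves to re-encode a small index set on \<open>'u\<close>, where the index categories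
  of \<open>cocomplete\<close> live.\<close>

lemma small_inj:
  assumes "small TYPE('u) S"
  obtains e :: "_ \<Rightarrow> 'u" where "inj_on e S"
proof -
  have "|S| \<le>o |UNIV :: 'u set|" using assms by (simp add: small_def ordLess_imp_ordLeq)
  then show ?thesis using that card_of_ordLeq[of S "UNIV :: 'u set"] by blast
qed

section \<open>The category of elements of a continuous presheaf\<close>

text \<open>Fixing \<open>b\<close> turns \<open>F\<close> into the presheaf
  \<open>Hom B b (fobj F -)\<close> on \<open>A\<close>, which is to be represented.
  \<open>S\<close> plays the part of a solution set: a small set of objects of which every object is
  a small colimit.\<close>

locale presheaf_elements = A: category A + B: category B + F: cat_functor "op_cat A" B F
  for A :: "('k, 'a, 'u) lincat" and B :: "('k, 'b, 'u) lincat" and F :: "('a, 'u, 'b, 'u) ftor" +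
  fixes b :: 'b and S :: "'a set"
  assumes universe: "universe TYPE('u)"
    and small_Hom_A: "\<lbrakk>X \<in> Obj A; Y \<in> Obj A\<rbrakk> \<Longrightarrow> small TYPE('u) (Hom A X Y)"
    and small_Hom_B: "\<lbrakk>U \<in> Obj B; V \<in> Obj B\<rbrakk> \<Longrightarrow> small TYPE('u) (Hom B U V)"
    and cocomplete: "cocomplete A"
    and continuous: "continuous (op_cat A) B F"
    and b: "b \<in> Obj B"
    and small_S: "small TYPE('u) S"
    and S_subset: "S \<subseteq> Obj A"
    and S_generates: "X \<in> Obj A \<Longrightarrow> \<exists>(J :: ('u, 'u) cat) D l. small_category J \<and> cat_functor J A D \<and>
      (\<forall>i\<in>Obj J. fobj D i \<in> S) \<and> is_colimit J A D X l"
begin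

definition elements :: "('a \<times> 'u) set" where
  "elements = {(X, x). X \<in> Obj A \<and> x \<in> Hom B b (fobj F X)}"

text \<open>The action of the presheaf on arrows: restriction of an element over \<open>Y\<close>
  along \<open>f\<close>.\<close>

definition pull :: "'a \<Rightarrow> 'a \<Rightarrow> 'u \<Rightarrow> 'u \<Rightarrow> 'u" where
  "pull X Y f y = Comp B b (fobj F Y) (fobj F X) (farr F Y X f) y"

text \<open>Arrows of the category of elements. Objects and arrows are kept as plain sets; only
  small full subcategories are later made into index categories.\<close>

definition elt_Hom :: "'a \<times> 'u \<Rightarrow> 'a \<times> 'u \<Rightarrow> 'u set" where
  "elt_Hom s t = {f \<in> Hom A (fst s) (fst t). pull (fst s) (fst t) f (snd t) = snd s}"

lemma elementsD: "s \<in> elements \<Longrightarrow> fst s \<in> Obj A \<and> snd s \<in> Hom B b (fobj F (fst s))"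
  by (auto simp: elements_def)

lemma fobj_closed': "X \<in> Obj A \<Longrightarrow> fobj F X \<in> Obj B"
  using F.fobj_closed by simp

lemma farr_closed': "\<lbrakk>X \<in> Obj A; Y \<in> Obj A; f \<in> Hom A X Y\<rbrakk> \<Longrightarrow> farr F Y X f \<in> Hom B (fobj F Y) (fobj F X)"
  using F.farr_closed by simp

lemma pull_closed:
  "\<lbrakk>X \<in> Obj A; Y \<in> Obj A; f \<in> Hom A X Y; y \<in> Hom B b (fobj F Y)\<rbrakk> \<Longrightarrow> pull X Y f y \<in> Hom B b (fobj F X)"
  by (simp add: pull_def B.Comp_closed b fobj_closed' farr_closed')

lemma pull_Ident: "X \<in> Obj A \<Longrightarrow> x \<in> Hom B b (fobj F X) \<Longrightarrow> pull X X (Ident A X) x = x"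
  using F.farr_Ident[of X] by (simp add: pull_def B.Comp_Ident_left b fobj_closed')

lemma pull_Comp:
  assumes "X \<in> Obj A" "Y \<in> Obj A" "Z \<in> Obj A" "f \<in> Hom A X Y" "g \<in> Hom A Y Z" "z \<in> Hom B b (fobj F Z)"
  shows "pull X Z (Comp A X Y Z g f) z = pull X Y f (pull Y Z g z)"
  using F.farr_Comp[of Z Y X g f] assms by (simp add: pull_def B.Comp_assoc b fobj_closed' farr_closed')

lemma elt_Hom_Comp:
  assumes "r \<in> elements" "s \<in> elements" "t \<in> elements" "f \<in> elt_Hom r s" "g \<in> elt_Hom s t"
  shows "Comp A (fst r) (fst s) (fst t) g f \<in> elt_Hom r t"
  using assms elementsD[of r] elementsD[of s] elementsD[of t]
  by (auto simp: elt_Hom_def A.Comp_closed pull_Comp)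

lemma elt_Hom_Ident: "s \<in> elements \<Longrightarrow> Ident A (fst s) \<in> elt_Hom s s"
  using elementsD[of s] by (simp add: elt_Hom_def A.Ident_closed pull_Ident)

text \<open>A compatible family of elements is a cone with vertex \<open>b\<close> over the image of
  the diagram. Since \<open>F\<close> sends the colimit to a limit in \<open>B\<close>, the family
  glues to exactly one element over \<open>c\<close>.\<close>

lemma colimit_pull_unique:
  fixes J :: "('u, 'u) cat"
  assumes J: "small_category J" and D: "cat_functor J A D" and c: "is_colimit J A D c l"
    and y: "\<And>i. i \<in> Obj J \<Longrightarrow> y i \<in> Hom B b (fobj F (fobj D i))"
    and compat: "\<And>i j u. \<lbrakk>i \<in> Obj J; j \<in> Obj J; u \<in> Hom J i j\<rbrakk>
      \<Longrightarrow> pull (fobj D i) (fobj D j) (farr D i j u) (y j) = y i"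
  shows "\<exists>!p. p \<in> Hom B b (fobj F c) \<and> (\<forall>i\<in>Obj J. pull (fobj D i) c (l i) p = y i)"
proof -
  interpret J: category J using J by (simp add: small_category_def)
  interpret D: cat_functor J A D by fact
  \<comment> \<open>\<open>continuous\<close> speaks of limits in \<open>op_cat A\<close>, so the
    diagram is transposed. The opposite of \<open>J\<close> is written out by hand because
    \<open>op_cat\<close> acts on \<open>lincat\<close> records.\<close>
  define J' :: "('u, 'u) cat" where "J' = \<lparr>Obj = Obj J, Hom = (\<lambda>i j. Hom J j i), Ident = Ident J,
    Comp = (\<lambda>X Y Z g f. Comp J Z Y X f g)\<rparr>"
  define D' :: "('u, 'u, 'a, 'u) ftor" where "D' = \<lparr>fobj = fobj D, farr = (\<lambda>i j u. farr D j i u)\<rparr>"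
  have [simp]: "Obj J' = Obj J" "Hom J' i j = Hom J j i" "Ident J' = Ident J"
    "Comp J' h i j v u = Comp J j i h u v" "fobj D' = fobj D" "farr D' i j u = farr D j i u"
    for h i j u v by (simp_all add: J'_def D'_def)
  interpret J': category J'
    by unfold_locales (simp_all add: J.Ident_closed J.Comp_closed J.Comp_Ident_left J.Comp_Ident_right J.Comp_assoc)
  have "arrows J' = (\<lambda>(i, j, u). (j, i, u)) ` arrows J" by (auto simp: arrows_def image_iff)
  then have "small_category J'"
    using J by (simp add: small_category_def J'.category_axioms small_image)
  moreover have "cat_functor J' (op_cat A) D'"
    by unfold_locales (simp_all add: D.fobj_closed D.farr_closed D.farr_Ident D.farr_Comp)
  moreover have cone: "is_cone J' (op_cat A) D' c' l' \<longleftrightarrow> is_cocone J A D c' l'" for c' l'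
    by (auto simp: is_cone_def is_cocone_def)
  then have "is_limit J' (op_cat A) D' c l" using c by (simp add: is_limit_def is_colimit_def)
  ultimately have "is_limit J' B (comp_ftor F D') (fobj F c) (\<lambda>i. farr F c (fobj D' i) (l i))"
    using continuous unfolding continuous_def by blast
  moreover have "is_cone J' B (comp_ftor F D') b y"
    using y compat by (auto simp: is_cone_def comp_ftor_def b pull_def)
  ultimately show ?thesis unfolding is_limit_def by (simp add: comp_ftor_def pull_def)
qed

text \<open>\<open>T\<close> stands for the full subcategory on \<open>T\<close> of the category of elements. The last clause is only
  the uniqueness part of the universal property, and concerns arrows of \<open>A\<close>.\<close>

definition elt_colimit :: "('a \<times> 'u) set \<Rightarrow> 'a \<times> 'u \<Rightarrow> ('a \<times> 'u \<Rightarrow> 'u) \<Rightarrow> bool" where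
  "elt_colimit T t l \<longleftrightarrow>
     t \<in> elements \<and> (\<forall>s\<in>T. l s \<in> elt_Hom s t) \<and>
     (\<forall>r\<in>T. \<forall>s\<in>T. \<forall>f\<in>elt_Hom r s. Comp A (fst r) (fst s) (fst t) (l s) f = l r) \<and>
     (\<forall>Y\<in>Obj A. \<forall>h\<in>Hom A (fst t) Y. \<forall>h'\<in>Hom A (fst t) Y.
        (\<forall>s\<in>T. Comp A (fst s) (fst t) Y h (l s) = Comp A (fst s) (fst t) Y h' (l s)) \<longrightarrow> h = h')"

lemma elt_colimitD:
  assumes "elt_colimit T t l"
  shows "t \<in> elements" and "s \<in> T \<Longrightarrow> l s \<in> elt_Hom s t"
    and "\<lbrakk>r \<in> T; s \<in> T; f \<in> elt_Hom r s\<rbrakk> \<Longrightarrow> Comp A (fst r) (fst s) (fst t) (l s) f = l r"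
    and "\<lbrakk>Y \<in> Obj A; h \<in> Hom A (fst t) Y; h' \<in> Hom A (fst t) Y;
        \<And>s. s \<in> T \<Longrightarrow> Comp A (fst s) (fst t) Y h (l s) = Comp A (fst s) (fst t) Y h' (l s)\<rbrakk>
      \<Longrightarrow> h = h'"
  using assms unfolding elt_colimit_def by blast+

text \<open>The projection to \<open>A\<close> lifts colimits: the underlying objects have a colimit
  \<open>c\<close> in \<open>A\<close>, and the elements themselves form a compatible family on the
  diagram, which glues to an element over \<open>c\<close>. The legs are then arrows of
  elements.\<close>

lemma elements_colimit:
  assumes T: "T \<subseteq> elements" and small_T: "small TYPE('u) T"
  shows "\<exists>t l. elt_colimit T t l"
proof -
  \<comment> \<open>\<open>e\<close> encodes the elements in \<open>'u\<close>, and \<open>d\<close>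
    decodes them.\<close>
  obtain e :: "'a \<times> 'u \<Rightarrow> 'u" where e: "inj_on e T" using small_inj[OF small_T] .
  define d where "d = inv_into T e"
  have de [simp]: "d (e s) = s" if "s \<in> T" for s using e that by (simp add: d_def)
  define J :: "('u, 'u) cat" where "J = \<lparr>Obj = e ` T, Hom = (\<lambda>i j. elt_Hom (d i) (d j)),
    Ident = (\<lambda>i. Ident A (fst (d i))), Comp = (\<lambda>i j k. Comp A (fst (d i)) (fst (d j)) (fst (d k)))\<rparr>"
  define D :: "('u, 'u, 'a, 'u) ftor" where "D = \<lparr>fobj = (\<lambda>i. fst (d i)), farr = (\<lambda>i j u. u)\<rparr>"
  have [simp]: "Obj J = e ` T" "Hom J i j = elt_Hom (d i) (d j)" "Ident J i = Ident A (fst (d i))"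
    "Comp J i j k = Comp A (fst (d i)) (fst (d j)) (fst (d k))" "fobj D i = fst (d i)" "farr D i j u = u"
    for i j k u by (simp_all add: J_def D_def)
  have elt: "s \<in> elements" "fst s \<in> Obj A" "snd s \<in> Hom B b (fobj F (fst s))" if "s \<in> T" for s
    using elementsD[of s] that T by auto
  have Hom: "f \<in> elt_Hom s t \<Longrightarrow> f \<in> Hom A (fst s) (fst t)" for f s t by (simp add: elt_Hom_def)
  have dT: "d i \<in> elements" "fst (d i) \<in> Obj A" "snd (d i) \<in> Hom B b (fobj F (fst (d i)))" if "i \<in> e ` T" for i
    using that elt by auto
  interpret J: category J
    by unfold_locales (simp_all add: dT elt_Hom_Ident elt_Hom_Comp Hom A.Comp_Ident_left
        A.Comp_Ident_right A.Comp_assoc)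
  \<comment> \<open>An arrow of \<open>J\<close> is given by two elements of \<open>T\<close> and an
    arrow of \<open>A\<close> between their underlying objects, so the arrows are covered by a small
    sum of Hom-sets.\<close>
  have "arrows J \<subseteq> (\<lambda>((s, t), f). (e s, e t, f)) `
    (SIGMA p:(SIGMA s:T. T). Hom A (fst (fst p)) (fst (snd p)))"
    by (force simp: arrows_def elt_Hom_def)
  moreover have "small TYPE('u) (SIGMA p:(SIGMA s:T. T). Hom A (fst (fst p)) (fst (snd p)))"
    by (intro small_Sigma universe small_T) (auto intro!: small_Hom_A dest: elt(2))
  ultimately have J: "small_category J"
    using small_mono[OF small_image] J.category_axioms by (auto simp: small_category_def)
  have D: "cat_functor J A D"
    by unfold_locales (simp_all add: dT Hom)
  obtain c m where c: "is_colimit J A D c m"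
    using cocomplete J D unfolding cocomplete_def by blast
  then have cObj: "c \<in> Obj A" and mHom: "\<And>s. s \<in> T \<Longrightarrow> m (e s) \<in> Hom A (fst s) c"
    and mComp: "\<And>r s f. r \<in> T \<Longrightarrow> s \<in> T \<Longrightarrow> f \<in> elt_Hom r s
      \<Longrightarrow> Comp A (fst r) (fst s) c (m (e s)) f = m (e r)"
    by (auto simp: is_colimit_def is_cocone_def)
  have "\<exists>!p. p \<in> Hom B b (fobj F c) \<and> (\<forall>i\<in>Obj J. pull (fobj D i) c (m i) p = snd (d i))"
    by (rule colimit_pull_unique[OF J D c]) (simp_all add: dT elt_Hom_def)
  then obtain p where "p \<in> Hom B b (fobj F c) \<and> (\<forall>i\<in>Obj J. pull (fobj D i) c (m i) p = snd (d i))"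
    by (elim ex1E) (rule that)
  then have p: "p \<in> Hom B b (fobj F c)" "\<And>s. s \<in> T \<Longrightarrow> pull (fst s) c (m (e s)) p = snd s"
    by simp_all
  have "h = h'" if Y: "Y \<in> Obj A" and h: "h \<in> Hom A c Y" "h' \<in> Hom A c Y"
    and eq: "\<forall>s\<in>T. Comp A (fst s) c Y h (m (e s)) = Comp A (fst s) c Y h' (m (e s))" for Y h h'
  proof -
    \<comment> \<open>Both \<open>h\<close> and \<open>h'\<close> factor the cocone obtained by
      composing the legs with \<open>h\<close>, so uniqueness of the factorization identifies
      them.\<close>
    have "is_cocone J A D Y (\<lambda>i. Comp A (fst (d i)) c Y h (m i))"
      using Y h
      by (auto simp: is_cocone_def A.Comp_closed elt cObj mHom mComp Hom simp flip: A.Comp_assoc)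
    then have "\<exists>!k. k \<in> Hom A c Y \<and> (\<forall>i\<in>Obj J. Comp A (fobj D i) c Y k (m i) = Comp A (fst (d i)) c Y h (m i))"
      using c unfolding is_colimit_def by blast
    moreover have "\<forall>i\<in>Obj J. Comp A (fobj D i) c Y h' (m i) = Comp A (fst (d i)) c Y h (m i)"
      using eq by auto
    ultimately show ?thesis using h by auto
  qed
  then have "elt_colimit T (c, p) (\<lambda>s. m (e s))"
    by (auto simp: elt_colimit_def elements_def cObj p elt_Hom_def mHom mComp)
  then show ?thesis by blast
qed

section \<open>Weakly terminal and terminal elements\<close>

text \<open>Take the colimit \<open>t\<close> of all elements over objects of \<open>S\<close>. An
  element over any \<open>Y\<close> restricts along a colimit presentation of \<open>Y\<close> to
  elements over \<open>S\<close>; their legs into \<open>t\<close> induce an arrow from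
  \<open>Y\<close>, which respects the elements because it does so on each leg.\<close>

lemma weakly_terminal_element:
  obtains w where "w \<in> elements" "\<And>s. s \<in> elements \<Longrightarrow> elt_Hom s w \<noteq> {}"
proof -
  define T where "T = (SIGMA X:S. Hom B b (fobj F X))"
  have T: "T \<subseteq> elements" using S_subset by (auto simp: T_def elements_def)
  have small_T: "small TYPE('u) T"
    unfolding T_def
    by (intro small_Sigma universe small_S small_Hom_B b) (use S_subset fobj_closed' in auto)
  obtain t l where tl: "elt_colimit T t l" using elements_colimit[OF T small_T] by blast
  note t = elt_colimitD(1)[OF tl] and l = elt_colimitD(2)[OF tl] and lComp = elt_colimitD(3)[OF tl]
  have tO: "fst t \<in> Obj A" "snd t \<in> Hom B b (fobj F (fst t))" using elementsD[OF t] by auto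
  have "elt_Hom s t \<noteq> {}" if s: "s \<in> elements" for s
  proof -
    obtain Y y where sY: "s = (Y, y)" and Y: "Y \<in> Obj A" and y: "y \<in> Hom B b (fobj F Y)"
      using s by (auto simp: elements_def)
    obtain J :: "('u, 'u) cat" and D m where J: "small_category J" and D: "cat_functor J A D"
      and S: "\<And>i. i \<in> Obj J \<Longrightarrow> fobj D i \<in> S" and c: "is_colimit J A D Y m"
      using S_generates[OF Y] by blast
    interpret D: cat_functor J A D by fact
    have m: "m i \<in> Hom A (fobj D i) Y" if "i \<in> Obj J" for i
      using c that by (auto simp: is_colimit_def is_cocone_def)
    have mComp: "Comp A (fobj D i) (fobj D j) Y (m j) (farr D i j u) = m i"
      if "i \<in> Obj J" "j \<in> Obj J" "u \<in> Hom J i j" for i j u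
      using c that by (auto simp: is_colimit_def is_cocone_def)
    \<comment> \<open>Restricting \<open>y\<close> along the legs lifts the diagram \<open>D\<close>
      to a diagram of elements belonging to \<open>T\<close>.\<close>
    define z where "z i = (fobj D i, pull (fobj D i) Y (m i) y)" for i
    have z: "z i \<in> T" if "i \<in> Obj J" for i
      using that by (simp add: T_def z_def S pull_closed D.fobj_closed Y m y)
    have zHom: "farr D i j u \<in> elt_Hom (z i) (z j)" if "i \<in> Obj J" "j \<in> Obj J" "u \<in> Hom J i j" for i j u
      using that pull_Comp[of "fobj D i" "fobj D j" Y "farr D i j u" "m j" y]
      by (simp add: elt_Hom_def z_def D.farr_closed D.fobj_closed m y Y mComp)
    have lz: "l (z i) \<in> Hom A (fobj D i) (fst t)" "pull (fobj D i) (fst t) (l (z i)) (snd t) = pull (fobj D i) Y (m i) y"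
      if "i \<in> Obj J" for i
      using l[OF z[OF that]] by (auto simp: elt_Hom_def z_def)
    have "is_cocone J A D (fst t) (\<lambda>i. l (z i))"
      unfolding is_cocone_def using tO lz lComp[OF z z zHom] by (auto simp: z_def)
    then obtain h where h: "h \<in> Hom A Y (fst t)"
      and hm: "\<And>i. i \<in> Obj J \<Longrightarrow> Comp A (fobj D i) Y (fst t) h (m i) = l (z i)"
      using c unfolding is_colimit_def by blast
    \<comment> \<open>Gluing is applied to the restrictions of \<open>y\<close> itself, and only
      uniqueness is wanted: an element over \<open>Y\<close> is determined by its restrictions along
      the \<open>m i\<close>.\<close>
    have "\<exists>!p. p \<in> Hom B b (fobj F Y) \<and> (\<forall>i\<in>Obj J. pull (fobj D i) Y (m i) p = pull (fobj D i) Y (m i) y)"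
      by (rule colimit_pull_unique[OF J D c])
        (simp_all add: pull_closed D.fobj_closed D.farr_closed Y m y mComp flip: pull_Comp)
    then obtain p where p: "\<And>x. x \<in> Hom B b (fobj F Y) \<Longrightarrow>
        (\<And>i. i \<in> Obj J \<Longrightarrow> pull (fobj D i) Y (m i) x = pull (fobj D i) Y (m i) y) \<Longrightarrow> x = p"
      by (elim ex1E) blast
    have "pull Y (fst t) h (snd t) = p"
    proof (rule p)
      show "pull Y (fst t) h (snd t) \<in> Hom B b (fobj F Y)"
        by (rule pull_closed[OF Y tO(1) h tO(2)])
      show "pull (fobj D i) Y (m i) (pull Y (fst t) h (snd t)) = pull (fobj D i) Y (m i) y"
        if "i \<in> Obj J" for i
        using that pull_Comp[of "fobj D i" Y "fst t" "m i" h "snd t"] D.fobj_closed Y tO h m hm lz by simp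
    qed
    moreover have "y = p" by (rule p[OF y refl])
    ultimately have "pull Y (fst t) h (snd t) = y" by simp
    then show ?thesis using h by (auto simp: elt_Hom_def sY)
  qed
  then show thesis using that t by blast
qed

text \<open>As in the general adjoint functor theorem, the joint coequalizer \<open>l\<close> of the endomorphisms
  of a weakly terminal object \<open>w\<close> is terminal: if \<open>q\<close> coequalizes two arrows into it and \<open>m\<close> is
  an arrow from the target of \<open>q\<close> to \<open>w\<close>, then \<open>m \<circ> q \<circ> l\<close> is an endomorphism of \<open>w\<close>, so
  that \<open>l \<circ> m \<circ> q \<circ> l = l\<close> and \<open>q\<close> is a split monomorphism.\<close>

lemma terminal_element:
  obtains t where "t \<in> elements" "\<And>s. s \<in> elements \<Longrightarrow> \<exists>!f. f \<in> elt_Hom s t"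
proof -
  obtain w where w: "w \<in> elements" and weak: "\<And>s. s \<in> elements \<Longrightarrow> elt_Hom s w \<noteq> {}"
    using weakly_terminal_element by metis
  \<comment> \<open>The full subcategory on \<open>w\<close> alone contains all endomorphisms of
    \<open>w\<close>. So \<open>lComp\<close> says that \<open>l w\<close> absorbs every
    endomorphism, and \<open>lepi\<close> that \<open>l w\<close> is an epimorphism.\<close>
  have "small TYPE('u) {w}" by (simp add: small_finite universe)
  then obtain t l where tl: "elt_colimit {w} t l" using elements_colimit[of "{w}"] w by blast
  note t = elt_colimitD(1)[OF tl] and l = elt_colimitD(2)[OF tl] and lComp = elt_colimitD(3)[OF tl]
    and lepi = elt_colimitD(4)[OF tl]
  have Hom: "f \<in> elt_Hom s t \<Longrightarrow> f \<in> Hom A (fst s) (fst t)" for f s t by (simp add: elt_Hom_def)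
  note O = conjunct1[OF elementsD]
  have "\<exists>!f. f \<in> elt_Hom s t" if s: "s \<in> elements" for s
  proof -
    obtain g where g: "g \<in> elt_Hom s w" using weak[OF s] by auto
    have ex: "Comp A (fst s) (fst w) (fst t) (l w) g \<in> elt_Hom s t"
      using elt_Hom_Comp[OF s w t g] l by simp
    have "u = v" if u: "u \<in> elt_Hom s t" and v: "v \<in> elt_Hom s t" for u v
    proof -
      \<comment> \<open>The colimit of the full subcategory on \<open>s\<close> and \<open>t\<close>
        serves as coequalizer: its leg at \<open>t\<close>, composed with any arrow from
        \<open>s\<close> to \<open>t\<close>, is the leg at \<open>s\<close>.\<close>
      have "small TYPE('u) {s, t}" by (simp add: small_finite universe)
      then obtain r k where rk: "elt_colimit {s, t} r k" using elements_colimit[of "{s, t}"] s t by blast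
      note r = elt_colimitD(1)[OF rk] and k = elt_colimitD(2)[OF rk] and kComp = elt_colimitD(3)[OF rk]
      define q where "q = k t"
      have q: "q \<in> elt_Hom t r" using k by (simp add: q_def)
      have quv: "Comp A (fst s) (fst t) (fst r) q u = Comp A (fst s) (fst t) (fst r) q v"
        using kComp u v by (simp add: q_def)
      obtain m where m: "m \<in> elt_Hom r w" using weak[OF r] by auto
      define lm where "lm = Comp A (fst r) (fst w) (fst t) (l w) m"
      have lm: "lm \<in> elt_Hom r t" unfolding lm_def using elt_Hom_Comp[OF r w t m] l by simp
      have lw: "l w \<in> elt_Hom w t" using l by simp
      define ql where "ql = Comp A (fst w) (fst t) (fst r) q (l w)"
      have ql: "ql \<in> elt_Hom w r" unfolding ql_def by (rule elt_Hom_Comp[OF w t r lw q])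
      note oo = O[OF s] O[OF t] O[OF r] O[OF w]
      note hh = Hom[OF q] Hom[OF m] Hom[OF lm] Hom[OF lw] Hom[OF ql] Hom[OF u] Hom[OF v]
      have "Comp A (fst w) (fst t) (fst t) (Comp A (fst t) (fst r) (fst t) lm q) (l w) =
        Comp A (fst w) (fst r) (fst t) lm ql"
        unfolding ql_def by (rule A.Comp_assoc[symmetric]) (simp_all add: oo hh)
      also have "\<dots> = Comp A (fst w) (fst w) (fst t) (l w) (Comp A (fst w) (fst r) (fst w) m ql)"
        unfolding lm_def by (rule A.Comp_assoc[symmetric]) (simp_all add: oo hh)
      also have "\<dots> = l w"
        using lComp elt_Hom_Comp[OF w r w ql m] by simp
      also have "\<dots> = Comp A (fst w) (fst t) (fst t) (Ident A (fst t)) (l w)"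
        by (simp add: A.Comp_Ident_left oo hh)
      finally have "Comp A (fst w) (fst t) (fst t) (Comp A (fst t) (fst r) (fst t) lm q) (l w) =
        Comp A (fst w) (fst t) (fst t) (Ident A (fst t)) (l w)" .
      \<comment> \<open>Cancelling the epimorphism \<open>l w\<close> leaves \<open>lm\<close> as a
        retraction of \<open>q\<close>.\<close>
      then have split: "Comp A (fst t) (fst r) (fst t) lm q = Ident A (fst t)"
        by - (rule lepi[OF O[OF t]], simp_all add: oo hh A.Comp_closed A.Ident_closed)
      have "u = Comp A (fst s) (fst r) (fst t) lm (Comp A (fst s) (fst t) (fst r) q u)"
        by (simp add: oo hh A.Comp_assoc split A.Comp_Ident_left)
      also have "\<dots> = v"
        unfolding quv by (simp add: oo hh A.Comp_assoc split A.Comp_Ident_left)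
      finally show ?thesis .
    qed
    then show ?thesis using ex by blast
  qed
  then show thesis using that t by blast
qed

text \<open>A terminal object of the category of elements is a universal element; its underlying
  object represents the presheaf.\<close>

lemma representable:
  obtains g e where "g \<in> Obj A" "e \<in> Hom B b (fobj F g)"
    "\<And>X x. \<lbrakk>X \<in> Obj A; x \<in> Hom B b (fobj F X)\<rbrakk>
      \<Longrightarrow> \<exists>!f. f \<in> Hom A X g \<and> Comp B b (fobj F g) (fobj F X) (farr F g X f) e = x"
proof -
  obtain t where t: "t \<in> elements" "\<And>s. s \<in> elements \<Longrightarrow> \<exists>!f. f \<in> elt_Hom s t"
    using terminal_element by metis
  show thesis
  proof (rule that[of "fst t" "snd t"])
    show "fst t \<in> Obj A" "snd t \<in> Hom B b (fobj F (fst t))" using elementsD[OF t(1)] by auto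
    show "\<exists>!f. f \<in> Hom A X (fst t) \<and> Comp B b (fobj F (fst t)) (fobj F X) (farr F (fst t) X f) (snd t) = x"
      if "X \<in> Obj A" "x \<in> Hom B b (fobj F X)" for X x
      using t(2)[of "(X, x)"] that by (simp add: elements_def elt_Hom_def pull_def)
  qed
qed

end


section \<open>Mutual adjunctions\<close>

text \<open>Only naturality of \<open>\<phi>\<close> is required, since that of its inverse
  \<open>\<psi>\<close> follows. Both variables are contravariant, which makes the notion symmetric
  in the two functors.\<close>

locale mutual_adjunction =
  F: lin_functor R "op_cat A" B F + G: lin_functor R "op_cat B" A G
  for R :: "'k ring" and A :: "('k, 'a, 'u) lincat" and B :: "('k, 'b, 'u) lincat"
    and F :: "('a, 'u, 'b, 'u) ftor" and G :: "('b, 'u, 'a, 'u) ftor" +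
  fixes \<phi> \<psi> :: "'a \<Rightarrow> 'b \<Rightarrow> 'u \<Rightarrow> 'u"
  assumes phi_closed: "\<lbrakk>X \<in> Obj A; Y \<in> Obj B; x \<in> Hom B Y (fobj F X)\<rbrakk> \<Longrightarrow> \<phi> X Y x \<in> Hom A X (fobj G Y)"
    and psi_closed: "\<lbrakk>X \<in> Obj A; Y \<in> Obj B; y \<in> Hom A X (fobj G Y)\<rbrakk> \<Longrightarrow> \<psi> X Y y \<in> Hom B Y (fobj F X)"
    and psi_phi: "\<lbrakk>X \<in> Obj A; Y \<in> Obj B; x \<in> Hom B Y (fobj F X)\<rbrakk> \<Longrightarrow> \<psi> X Y (\<phi> X Y x) = x"
    and phi_psi: "\<lbrakk>X \<in> Obj A; Y \<in> Obj B; y \<in> Hom A X (fobj G Y)\<rbrakk> \<Longrightarrow> \<phi> X Y (\<psi> X Y y) = y"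
    and phi_natural_left:
      "\<lbrakk>X \<in> Obj A; X' \<in> Obj A; Y \<in> Obj B; f \<in> Hom A X' X; x \<in> Hom B Y (fobj F X)\<rbrakk>
        \<Longrightarrow> \<phi> X' Y (Comp B Y (fobj F X) (fobj F X') (farr F X X' f) x)
            = Comp A X' X (fobj G Y) (\<phi> X Y x) f"
    and phi_natural_right:
      "\<lbrakk>X \<in> Obj A; Y \<in> Obj B; Y' \<in> Obj B; v \<in> Hom B Y' Y; x \<in> Hom B Y (fobj F X)\<rbrakk>
        \<Longrightarrow> \<phi> X Y' (Comp B Y' Y (fobj F X) x v)
            = Comp A X (fobj G Y) (fobj G Y') (farr G Y Y' v) (\<phi> X Y x)"
begin

lemma F_obj: "X \<in> Obj A \<Longrightarrow> fobj F X \<in> Obj B"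
  and G_obj: "Y \<in> Obj B \<Longrightarrow> fobj G Y \<in> Obj A"
  and F_arr: "\<lbrakk>X \<in> Obj A; X' \<in> Obj A; f \<in> Hom A X' X\<rbrakk> \<Longrightarrow> farr F X X' f \<in> Hom B (fobj F X) (fobj F X')"
  and G_arr: "\<lbrakk>Y \<in> Obj B; Y' \<in> Obj B; v \<in> Hom B Y' Y\<rbrakk> \<Longrightarrow> farr G Y Y' v \<in> Hom A (fobj G Y) (fobj G Y')"
  using F.fobj_closed G.fobj_closed F.farr_closed G.farr_closed by simp_all

lemma psi_natural_left:
  assumes "X \<in> Obj A" "X' \<in> Obj A" "Y \<in> Obj B" "f \<in> Hom A X' X" "y \<in> Hom A X (fobj G Y)"
  shows "\<psi> X' Y (Comp A X' X (fobj G Y) y f)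
    = Comp B Y (fobj F X) (fobj F X') (farr F X X' f) (\<psi> X Y y)"
proof -
  have "Comp A X' X (fobj G Y) y f
      = \<phi> X' Y (Comp B Y (fobj F X) (fobj F X') (farr F X X' f) (\<psi> X Y y))"
    using assms by (simp add: phi_natural_left psi_closed phi_psi)
  then show ?thesis
    using assms by (simp add: psi_phi psi_closed F.cod.Comp_closed F_obj F_arr)
qed

lemma psi_natural_right:
  assumes "X \<in> Obj A" "Y \<in> Obj B" "Y' \<in> Obj B" "v \<in> Hom B Y' Y" "y \<in> Hom A X (fobj G Y)"
  shows "\<psi> X Y' (Comp A X (fobj G Y) (fobj G Y') (farr G Y Y' v) y)
    = Comp B Y' Y (fobj F X) (\<psi> X Y y) v"
proof -
  have "Comp A X (fobj G Y) (fobj G Y') (farr G Y Y' v) y = \<phi> X Y' (Comp B Y' Y (fobj F X) (\<psi> X Y y) v)"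
    using assms by (simp add: phi_natural_right psi_closed phi_psi)
  then show ?thesis
    using assms by (simp add: psi_phi psi_closed F.cod.Comp_closed F_obj)
qed

text \<open>Through this symmetry, facts about one functor transfer to the other.\<close>

lemma swap: "mutual_adjunction R B A G F (\<lambda>Y X. \<psi> X Y) (\<lambda>Y X. \<phi> X Y)"
  by (intro mutual_adjunction.intro mutual_adjunction_axioms.intro F.lin_functor_axioms G.lin_functor_axioms)
    (simp_all add: phi_closed psi_closed phi_psi psi_phi psi_natural_left psi_natural_right)

text \<open>The Yoneda argument: naturality in \<open>Y\<close> determines \<open>\<phi>\<close> by
  its value at an identity, the unit. Writing \<open>\<phi>\<close> through \<open>farr G\<close>
  makes its linearity a consequence of that of \<open>G\<close>.\<close>

lemma phi_eq:
  assumes "X \<in> Obj A" "Y \<in> Obj B" "x \<in> Hom B Y (fobj F X)"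
  shows "\<phi> X Y x = Comp A X (fobj G (fobj F X)) (fobj G Y) (farr G (fobj F X) Y x)
    (\<phi> X (fobj F X) (Ident B (fobj F X)))"
  using assms phi_natural_right[of X "fobj F X" Y x "Ident B (fobj F X)"]
  by (simp add: F.cod.Comp_Ident_left F.cod.Ident_closed F_obj)

lemma
  assumes "X \<in> Obj A" "Y \<in> Obj B"
  shows phi_hadd: "\<And>x y. \<lbrakk>x \<in> Hom B Y (fobj F X); y \<in> Hom B Y (fobj F X)\<rbrakk>
      \<Longrightarrow> \<phi> X Y (hadd B Y (fobj F X) x y) = hadd A X (fobj G Y) (\<phi> X Y x) (\<phi> X Y y)"
    and phi_hsmult: "\<And>a x. \<lbrakk>a \<in> carrier R; x \<in> Hom B Y (fobj F X)\<rbrakk>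
      \<Longrightarrow> \<phi> X Y (hsmult B Y (fobj F X) a x) = hsmult A X (fobj G Y) a (\<phi> X Y x)"
proof -
  have u: "\<phi> X (fobj F X) (Ident B (fobj F X)) \<in> Hom A X (fobj G (fobj F X))"
    using assms by (simp add: phi_closed F.cod.Ident_closed F_obj)
  show "\<phi> X Y (hadd B Y (fobj F X) x y) = hadd A X (fobj G Y) (\<phi> X Y x) (\<phi> X Y y)"
    if "x \<in> Hom B Y (fobj F X)" "y \<in> Hom B Y (fobj F X)" for x y
    using assms that u G.farr_hadd[of "fobj F X" Y x y]
    by (simp add: phi_eq[of X Y] F.cod.hadd_closed F_obj G_obj G_arr G.cod.Comp_hadd_left)
  show "\<phi> X Y (hsmult B Y (fobj F X) a x) = hsmult A X (fobj G Y) a (\<phi> X Y x)"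
    if "a \<in> carrier R" "x \<in> Hom B Y (fobj F X)" for a x
    using assms that u G.farr_hsmult[of "fobj F X" Y a x]
    by (simp add: phi_eq[of X Y] F.cod.hsmult_closed F_obj G_obj G_arr G.cod.Comp_hsmult_left)
qed

text \<open>A cone with vertex \<open>X\<close> over \<open>G \<circ> D\<close> corresponds under \<open>\<psi>\<close> to a cocone under \<open>D\<close> in \<open>B\<close>
  with vertex \<open>F X\<close>.\<close>

lemma continuous_right: "continuous (op_cat B) A G"
  unfolding continuous_def
proof (intro allI impI, elim conjE)
  fix J :: "('u, 'u) cat" and D c l
  assume D: "cat_functor J (op_cat B) D" and lim: "is_limit J (op_cat B) D c l"
  interpret D: cat_functor J "op_cat B" D by fact
  have c: "c \<in> Obj B" and l: "\<And>i. i \<in> Obj J \<Longrightarrow> l i \<in> Hom B (fobj D i) c"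
    and lc: "\<And>i j u. \<lbrakk>i \<in> Obj J; j \<in> Obj J; u \<in> Hom J i j\<rbrakk>
      \<Longrightarrow> Comp B (fobj D j) (fobj D i) c (l i) (farr D i j u) = l j"
    using lim by (auto simp: is_limit_def is_cone_def)
  have Do: "fobj D i \<in> Obj B" if "i \<in> Obj J" for i using D.fobj_closed that by simp
  have Da: "farr D i j u \<in> Hom B (fobj D j) (fobj D i)" if "i \<in> Obj J" "j \<in> Obj J" "u \<in> Hom J i j" for i j u
    using D.farr_closed that by simp
  show "is_limit J A (comp_ftor G D) (fobj G c) (\<lambda>i. farr G c (fobj D i) (l i))"
    unfolding is_limit_def
  proof (intro conjI allI impI)
    show "is_cone J A (comp_ftor G D) (fobj G c) (\<lambda>i. farr G c (fobj D i) (l i))"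
      using G.farr_Comp[of c _ _ "l _" "farr D _ _ _"]
      by (simp add: is_cone_def comp_ftor_def c l lc Do Da G_obj G_arr flip: lc)
    fix X m assume "is_cone J A (comp_ftor G D) X m"
    then have X: "X \<in> Obj A" and m: "\<And>i. i \<in> Obj J \<Longrightarrow> m i \<in> Hom A X (fobj G (fobj D i))"
      and mc: "\<And>i j u. \<lbrakk>i \<in> Obj J; j \<in> Obj J; u \<in> Hom J i j\<rbrakk> \<Longrightarrow>
        Comp A X (fobj G (fobj D i)) (fobj G (fobj D j)) (farr G (fobj D i) (fobj D j) (farr D i j u)) (m i) = m j"
      by (auto simp: is_cone_def comp_ftor_def)
    define n where "n i = \<psi> X (fobj D i) (m i)" for i
    have "is_cone J (op_cat B) D (fobj F X) n"
      using psi_natural_right[OF X Do Do Da m]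
      by (simp add: is_cone_def n_def F_obj X psi_closed m Do mc)
    then have "\<exists>!h. h \<in> Hom B c (fobj F X) \<and> (\<forall>i\<in>Obj J. Comp B (fobj D i) c (fobj F X) h (l i) = n i)"
      using lim by (simp add: is_limit_def)
    then obtain h where h: "h \<in> Hom B c (fobj F X)"
        "\<And>i. i \<in> Obj J \<Longrightarrow> Comp B (fobj D i) c (fobj F X) h (l i) = n i"
      and uniq: "\<And>h'. h' \<in> Hom B c (fobj F X) \<Longrightarrow>
        (\<And>i. i \<in> Obj J \<Longrightarrow> Comp B (fobj D i) c (fobj F X) h' (l i) = n i) \<Longrightarrow> h' = h"
      by (elim ex1E) blast
    show "\<exists>!h. h \<in> Hom A X (fobj G c) \<and>
      (\<forall>i\<in>Obj J. Comp A X (fobj G c) (fobj (comp_ftor G D) i) (farr G c (fobj D i) (l i)) h = m i)"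
    proof (intro ex1I conjI ballI)
      show "\<phi> X c h \<in> Hom A X (fobj G c)" by (rule phi_closed[OF X c h(1)])
      show "Comp A X (fobj G c) (fobj (comp_ftor G D) i) (farr G c (fobj D i) (l i)) (\<phi> X c h) = m i"
        if "i \<in> Obj J" for i
        using that phi_natural_right[OF X c Do l h(1), of i] by (simp add: comp_ftor_def h n_def phi_psi X Do m)
      fix k assume k: "k \<in> Hom A X (fobj G c) \<and>
        (\<forall>i\<in>Obj J. Comp A X (fobj G c) (fobj (comp_ftor G D) i) (farr G c (fobj D i) (l i)) k = m i)"
      have "\<psi> X c k = h"
      proof (rule uniq)
        show "\<psi> X c k \<in> Hom B c (fobj F X)" using k X c by (simp add: psi_closed)
        show "Comp B (fobj D i) c (fobj F X) (\<psi> X c k) (l i) = n i" if "i \<in> Obj J" for i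
          using that k psi_natural_right[OF X c Do l, of i k] by (simp add: n_def comp_ftor_def)
      qed
      then show "k = \<phi> X c h" using k phi_psi[OF X c] by auto
    qed
  qed
qed

end

section \<open>Construction of the adjoint from representing objects\<close>

text \<open>Choose a universal element \<open>e Y\<close> over an object \<open>g Y\<close> for each
  \<open>Y\<close>. The action of \<open>G\<close> on arrows is then forced, and the laws for
  \<open>G\<close> and \<open>\<phi>\<close> follow by comparing restrictions of universal
  elements.\<close>

lemma exists_mutual_adjunction:
  fixes A :: "('k, 'a, 'u) lincat" and B :: "('k, 'b, 'u) lincat"
  assumes A: "lin_category R A" and B: "lin_category R B" and F: "lin_functor R (op_cat A) B F"
    and repr: "\<And>Y. Y \<in> Obj B \<Longrightarrow> \<exists>g e. g \<in> Obj A \<and> e \<in> Hom B Y (fobj F g) \<and>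
      (\<forall>X x. X \<in> Obj A \<longrightarrow> x \<in> Hom B Y (fobj F X) \<longrightarrow>
        (\<exists>!f. f \<in> Hom A X g \<and> Comp B Y (fobj F g) (fobj F X) (farr F g X f) e = x))"
  shows "\<exists>G \<phi> \<psi>. mutual_adjunction R A B F G \<phi> \<psi> \<and> ftor_extensional (op_cat B) G"
proof -
  interpret A: lin_category R A by fact
  interpret B: lin_category R B by fact
  interpret F: lin_functor R "op_cat A" B F by fact
  have Fo: "fobj F X \<in> Obj B" if "X \<in> Obj A" for X using F.fobj_closed that by simp
  have Fa: "farr F X X' f \<in> Hom B (fobj F X) (fobj F X')"
    if "X \<in> Obj A" "X' \<in> Obj A" "f \<in> Hom A X' X" for X X' f using F.farr_closed that by simp
  define Q where "Q Y p \<longleftrightarrow> fst p \<in> Obj A \<and> snd p \<in> Hom B Y (fobj F (fst p)) \<and>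
      (\<forall>X x. X \<in> Obj A \<longrightarrow> x \<in> Hom B Y (fobj F X) \<longrightarrow>
        (\<exists>!f. f \<in> Hom A X (fst p) \<and> Comp B Y (fobj F (fst p)) (fobj F X) (farr F (fst p) X f) (snd p) = x))"
    for Y p
  have "\<forall>Y\<in>Obj B. \<exists>p. Q Y p" using repr unfolding Q_def by simp
  then obtain p where p: "\<forall>Y\<in>Obj B. Q Y (p Y)" using bchoice[of "Obj B" Q] by blast
  define g e where "g Y = fst (p Y)" and "e Y = snd (p Y)" for Y
  have g: "g Y \<in> Obj A" and e: "e Y \<in> Hom B Y (fobj F (g Y))"
    and univ: "\<And>X x. \<lbrakk>X \<in> Obj A; x \<in> Hom B Y (fobj F X)\<rbrakk> \<Longrightarrow>
        \<exists>!f. f \<in> Hom A X (g Y) \<and> Comp B Y (fobj F (g Y)) (fobj F X) (farr F (g Y) X f) (e Y) = x"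
    if "Y \<in> Obj B" for Y
    using bspec[OF p that] unfolding Q_def g_def e_def by blast+
  \<comment> \<open>\<open>\<psi>\<close> restricts the universal element along an arrow, and
    \<open>\<phi>\<close> recovers the unique arrow from the restriction.\<close>
  define \<phi> where "\<phi> X Y x =
    (THE f. f \<in> Hom A X (g Y) \<and> Comp B Y (fobj F (g Y)) (fobj F X) (farr F (g Y) X f) (e Y) = x)" for X Y x
  define \<psi> where "\<psi> X Y y = Comp B Y (fobj F (g Y)) (fobj F X) (farr F (g Y) X y) (e Y)" for X Y y
  have phi: "\<phi> X Y x \<in> Hom A X (g Y)" "\<psi> X Y (\<phi> X Y x) = x"
    if "X \<in> Obj A" "Y \<in> Obj B" "x \<in> Hom B Y (fobj F X)" for X Y x
    using theI'[OF univ[OF that(2,1,3)]] by (simp_all add: \<phi>_def \<psi>_def)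
  have psi: "\<psi> X Y y \<in> Hom B Y (fobj F X)" if "X \<in> Obj A" "Y \<in> Obj B" "y \<in> Hom A X (g Y)" for X Y y
    using that by (simp add: \<psi>_def B.Comp_closed e Fa Fo g)
  \<comment> \<open>From here on, equations between arrows into \<open>g Y\<close> are proved by
    comparing their images under \<open>\<psi>\<close>.\<close>
  have psi_inj: "y = y'" if "X \<in> Obj A" "Y \<in> Obj B" "y \<in> Hom A X (g Y)" "y' \<in> Hom A X (g Y)"
    "\<psi> X Y y = \<psi> X Y y'" for X Y y y'
  proof -
    note ex1 = univ[OF that(2,1) psi[OF that(1-3)]]
    obtain z where z: "\<And>f. f \<in> Hom A X (g Y) \<Longrightarrow> \<psi> X Y f = \<psi> X Y y \<Longrightarrow> f = z"
      using ex1 unfolding \<psi>_def by (elim ex1E) blast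
    show ?thesis using z[OF that(3) refl] z[OF that(4) that(5)[symmetric]] by simp
  qed
  have phi_psi: "\<phi> X Y (\<psi> X Y y) = y" if "X \<in> Obj A" "Y \<in> Obj B" "y \<in> Hom A X (g Y)" for X Y y
    using that by - (rule psi_inj[of X Y], simp_all add: phi psi)
  have psi_left: "\<psi> X' Y (Comp A X' X (g Y) y f)
      = Comp B Y (fobj F X) (fobj F X') (farr F X X' f) (\<psi> X Y y)"
    if "X \<in> Obj A" "X' \<in> Obj A" "Y \<in> Obj B" "f \<in> Hom A X' X" "y \<in> Hom A X (g Y)" for X X' Y f y
    using that F.farr_Comp[of "g Y" X X' y f] by (simp add: \<psi>_def B.Comp_assoc e Fa Fo g)
  \<comment> \<open>\<open>farr G Y Y' v\<close> is the arrow along which \<open>e Y'\<close>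
    restricts to the composite of \<open>v\<close> with \<open>e Y\<close>. The value
    \<open>undefined\<close> off the domain makes \<open>G\<close> extensional, as membership in
    \<open>Cont\<close> demands.\<close>
  define G :: "('b, 'u, 'a, 'u) ftor" where "G =
    \<lparr>fobj = restrict g (Obj B),
     farr = (\<lambda>Y Y' v. if Y \<in> Obj B \<and> Y' \<in> Obj B \<and> v \<in> Hom B Y' Y
       then \<phi> (g Y) Y' (Comp B Y' Y (fobj F (g Y)) (e Y) v) else undefined)\<rparr>"
  have G_obj [simp]: "fobj G Y = g Y" if "Y \<in> Obj B" for Y
    using that by (simp add: G_def)
  have ev: "Comp B Y' Y (fobj F (g Y)) (e Y) v \<in> Hom B Y' (fobj F (g Y))"
    if "Y \<in> Obj B" "Y' \<in> Obj B" "v \<in> Hom B Y' Y" for Y Y' v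
    using that by (simp add: B.Comp_closed e Fo g)
  have G_arr: "farr G Y Y' v \<in> Hom A (g Y) (g Y')"
      "\<psi> (g Y) Y' (farr G Y Y' v) = Comp B Y' Y (fobj F (g Y)) (e Y) v"
    if "Y \<in> Obj B" "Y' \<in> Obj B" "v \<in> Hom B Y' Y" for Y Y' v
    using that by (simp_all add: G_def phi ev g)
  have psi_right: "\<psi> X Y' (Comp A X (g Y) (g Y') (farr G Y Y' v) y) = Comp B Y' Y (fobj F X) (\<psi> X Y y) v"
    if "X \<in> Obj A" "Y \<in> Obj B" "Y' \<in> Obj B" "v \<in> Hom B Y' Y" "y \<in> Hom A X (g Y)" for X Y Y' v y
  proof -
    have "\<psi> X Y' (Comp A X (g Y) (g Y') (farr G Y Y' v) y)
        = Comp B Y' (fobj F (g Y)) (fobj F X) (farr F (g Y) X y) (Comp B Y' Y (fobj F (g Y)) (e Y) v)"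
      using that by (simp add: psi_left G_arr g)
    also have "\<dots> = Comp B Y' Y (fobj F X) (\<psi> X Y y) v"
      using that by (simp add: \<psi>_def B.Comp_assoc e Fa Fo g)
    finally show ?thesis .
  qed
  have psi_e: "\<psi> (g Y) Y (Ident A (g Y)) = e Y" if "Y \<in> Obj B" for Y
    using that F.farr_Ident[of "g Y"] by (simp add: \<psi>_def B.Comp_Ident_left e Fo g)
  have ext: "ftor_extensional (op_cat B) G"
    by (auto simp: ftor_extensional_def G_def)
  interpret opB: lin_category R "op_cat B" by (rule lin_category_op_cat[OF B])
  have "cat_functor (op_cat B) A G"
  proof (intro cat_functor.intro cat_functor_axioms.intro opB.category_axioms A.category_axioms)
    show "fobj G Y \<in> Obj A" if "Y \<in> Obj (op_cat B)" for Y using that g by simp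
    show "farr G Y Y' v \<in> Hom A (fobj G Y) (fobj G Y')"
      if "Y \<in> Obj (op_cat B)" "Y' \<in> Obj (op_cat B)" "v \<in> Hom (op_cat B) Y Y'" for Y Y' v
      using that G_arr by simp
    show "farr G Y Y (Ident (op_cat B) Y) = Ident A (fobj G Y)" if "Y \<in> Obj (op_cat B)" for Y
      using that
        by - (rule psi_inj[of "g Y" Y], simp_all add: g G_arr B.Ident_closed A.Ident_closed psi_e B.Comp_Ident_right e Fo)
    show "farr G Y Z (Comp (op_cat B) Y X Z w v)
        = Comp A (fobj G Y) (fobj G X) (fobj G Z) (farr G X Z w) (farr G Y X v)"
      if "Y \<in> Obj (op_cat B)" "X \<in> Obj (op_cat B)" "Z \<in> Obj (op_cat B)"
        "v \<in> Hom (op_cat B) Y X" "w \<in> Hom (op_cat B) X Z" for X Y Z v w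
      using that
        by - (rule psi_inj[of "g Y" Z], simp_all add: g G_arr B.Comp_closed A.Comp_closed psi_right B.Comp_assoc e Fo)
  qed
  then have "lin_functor R (op_cat B) A G"
  proof (rule lin_functor.intro[OF _ opB.lin_category_axioms A lin_functor_axioms.intro])
    fix Y Y' assume Y: "Y \<in> Obj (op_cat B)" "Y' \<in> Obj (op_cat B)"
    show "farr G Y Y' \<in> mod_hom R (hom_module (op_cat B) Y Y') (hom_module A (fobj G Y) (fobj G Y'))"
    proof (rule mod_hom_hom_moduleI)
      show "farr G Y Y' v \<in> Hom A (fobj G Y) (fobj G Y')" if "v \<in> Hom (op_cat B) Y Y'" for v
        using that Y G_arr by simp
      show "farr G Y Y' (hadd (op_cat B) Y Y' v w) = hadd A (fobj G Y) (fobj G Y') (farr G Y Y' v) (farr G Y Y' w)"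
        if "v \<in> Hom (op_cat B) Y Y'" "w \<in> Hom (op_cat B) Y Y'" for v w
      proof (rule psi_inj[of "g Y" Y'])
        have "\<psi> (g Y) Y' (hadd A (g Y) (g Y') (farr G Y Y' v) (farr G Y Y' w))
          = hadd B Y' (fobj F (g Y)) (\<psi> (g Y) Y' (farr G Y Y' v)) (\<psi> (g Y) Y' (farr G Y Y' w))"
          using Y that F.farr_hadd[of "g Y'" "g Y" "farr G Y Y' v" "farr G Y Y' w"]
          by (simp add: \<psi>_def g e Fo Fa G_arr B.Comp_hadd_left)
        then show "\<psi> (g Y) Y' (farr G Y Y' (hadd (op_cat B) Y Y' v w))
          = \<psi> (g Y) Y' (hadd A (fobj G Y) (fobj G Y') (farr G Y Y' v) (farr G Y Y' w))"
          using Y that by (simp add: g e Fo G_arr B.hadd_closed B.Comp_hadd_right)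
      qed (use Y that in \<open>simp_all add: g G_arr A.hadd_closed B.hadd_closed\<close>)
      show "farr G Y Y' (hsmult (op_cat B) Y Y' a v) = hsmult A (fobj G Y) (fobj G Y') a (farr G Y Y' v)"
        if "a \<in> carrier R" "v \<in> Hom (op_cat B) Y Y'" for a v
      proof (rule psi_inj[of "g Y" Y'])
        have "\<psi> (g Y) Y' (hsmult A (g Y) (g Y') a (farr G Y Y' v))
          = hsmult B Y' (fobj F (g Y)) a (\<psi> (g Y) Y' (farr G Y Y' v))"
          using Y that F.farr_hsmult[of "g Y'" "g Y" a "farr G Y Y' v"]
          by (simp add: \<psi>_def g e Fo Fa G_arr B.Comp_hsmult_left)
        then show "\<psi> (g Y) Y' (farr G Y Y' (hsmult (op_cat B) Y Y' a v))
          = \<psi> (g Y) Y' (hsmult A (fobj G Y) (fobj G Y') a (farr G Y Y' v))"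
          using Y that by (simp add: g e Fo G_arr B.hsmult_closed B.Comp_hsmult_right)
      qed (use Y that in \<open>simp_all add: g G_arr A.hsmult_closed B.hsmult_closed\<close>)
    qed
  qed
  then have "mutual_adjunction R A B F G \<phi> \<psi>"
  proof (intro mutual_adjunction.intro mutual_adjunction_axioms.intro F)
    show "\<phi> X' Y (Comp B Y (fobj F X) (fobj F X') (farr F X X' f) x) = Comp A X' X (fobj G Y) (\<phi> X Y x) f"
      if "X \<in> Obj A" "X' \<in> Obj A" "Y \<in> Obj B" "f \<in> Hom A X' X" "x \<in> Hom B Y (fobj F X)" for X X' Y f x
      using that
        by - (rule psi_inj[of X' Y], simp_all add: phi psi_left A.Comp_closed B.Comp_closed Fo Fa g)
    show "\<phi> X Y' (Comp B Y' Y (fobj F X) x v) = Comp A X (fobj G Y) (fobj G Y') (farr G Y Y' v) (\<phi> X Y x)"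
      if "X \<in> Obj A" "Y \<in> Obj B" "Y' \<in> Obj B" "v \<in> Hom B Y' Y" "x \<in> Hom B Y (fobj F X)" for X Y Y' v x
      using that
        by - (rule psi_inj[of X Y'], simp_all add: phi psi_right A.Comp_closed B.Comp_closed Fo g G_arr)
  qed (simp_all add: phi psi phi_psi)
  then show ?thesis using ext by blast
qed

text \<open>Local presentability of \<open>A\<close> supplies colimits and the small generating set
  \<open>S\<close>, so the presheaves \<open>Hom B Y (fobj F -)\<close> are representable. The
  resulting \<open>G\<close> is continuous because it belongs to a mutual adjunction.\<close>

lemma LP_tensor_adjoint:
  fixes A :: "('k, 'a, 'u) lincat" and B :: "('k, 'b, 'u) lincat"
  assumes U: "universe TYPE('u)" and A: "locally_presentable R A" and B: "locally_presentable R B"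
    and F: "F \<in> Obj (LP_tensor R A B)"
  shows "\<exists>G \<phi> \<psi>. G \<in> Obj (LP_tensor R B A) \<and> mutual_adjunction R A B F G \<phi> \<psi>"
proof -
  have linA: "lin_category R A" and smallA: "\<And>X Y. X \<in> Obj A \<Longrightarrow> Y \<in> Obj A \<Longrightarrow> small TYPE('u) (Hom A X Y)"
    and cA: "cocomplete A"
    using A by (auto simp: locally_presentable_def locally_presentable_at_def)
  have linB: "lin_category R B" and smallB: "\<And>X Y. X \<in> Obj B \<Longrightarrow> Y \<in> Obj B \<Longrightarrow> small TYPE('u) (Hom B X Y)"
    using B by (auto simp: locally_presentable_def locally_presentable_at_def)
  obtain \<alpha> :: "'u rel" and S where S: "small TYPE('u) S" and pres: "\<forall>X\<in>S. presentable R \<alpha> A X"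
    and filt: "\<forall>X\<in>Obj A. \<exists>J D l. small_category J \<and> filtered \<alpha> J \<and> cat_functor J A D \<and>
      (\<forall>i\<in>Obj J. fobj D i \<in> S) \<and> is_colimit J A D X l"
    using A unfolding locally_presentable_def locally_presentable_at_def by blast
  have S_obj: "S \<subseteq> Obj A" using pres by (auto simp: presentable_def)
  have gen: "\<exists>(J :: ('u, 'u) cat) D l. small_category J \<and> cat_functor J A D \<and>
      (\<forall>i\<in>Obj J. fobj D i \<in> S) \<and> is_colimit J A D X l" if "X \<in> Obj A" for X
    using bspec[OF filt that] by blast
  have linF: "lin_functor R (op_cat A) B F" and cF: "continuous (op_cat A) B F"
    using F by (simp_all add: LP_tensor_def Cont_simps)
  interpret A: lin_category R A by fact
  interpret B: lin_category R B by fact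
  interpret F: lin_functor R "op_cat A" B F by fact
  have "\<exists>g e. g \<in> Obj A \<and> e \<in> Hom B Y (fobj F g) \<and>
      (\<forall>X x. X \<in> Obj A \<longrightarrow> x \<in> Hom B Y (fobj F X) \<longrightarrow>
        (\<exists>!f. f \<in> Hom A X g \<and> Comp B Y (fobj F g) (fobj F X) (farr F g X f) e = x))"
    if Y: "Y \<in> Obj B" for Y
  proof -
    interpret presheaf_elements A B F Y S
      by unfold_locales (fact U smallA smallB cA cF Y S S_obj gen)+
    show ?thesis using representable by metis
  qed
  from exists_mutual_adjunction[OF linA linB linF this] obtain G \<phi> \<psi>
    where adj: "mutual_adjunction R A B F G \<phi> \<psi>" and "ftor_extensional (op_cat B) G"
    by blast
  moreover have "lin_functor R (op_cat B) A G" using adj mutual_adjunction.axioms(2) by blast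
  moreover have "continuous (op_cat B) A G" by (rule mutual_adjunction.continuous_right[OF adj])
  ultimately show ?thesis by (auto simp: LP_tensor_def Cont_simps)
qed


section \<open>Mates\<close>

text \<open>The adjunction bijections carry composition with \<open>t\<close> to composition with
  \<open>s\<close>. In contrast to mates of left and right adjoints, the direction is kept:
  \<open>t\<close> from \<open>F\<close> to \<open>F'\<close> belongs to \<open>s\<close> from
  \<open>G\<close> to \<open>G'\<close>.\<close>

definition mates where
  "mates A B F G \<phi> F' G' \<phi>' t s \<longleftrightarrow>
     (\<forall>X\<in>Obj A. \<forall>Y\<in>Obj B. \<forall>x\<in>Hom B Y (fobj F X).
        \<phi>' X Y (Comp B Y (fobj F X) (fobj F' X) (t X) x)
        = Comp A X (fobj G Y) (fobj G' Y) (s Y) (\<phi> X Y x))"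

lemma matesD:
  assumes "mates A B F G \<phi> F' G' \<phi>' t s" "X \<in> Obj A" "Y \<in> Obj B" "x \<in> Hom B Y (fobj F X)"
  shows "\<phi>' X Y (Comp B Y (fobj F X) (fobj F' X) (t X) x)
    = Comp A X (fobj G Y) (fobj G' Y) (s Y) (\<phi> X Y x)"
  using assms by (simp add: mates_def)

lemma matesI:
  assumes "\<And>X Y x. \<lbrakk>X \<in> Obj A; Y \<in> Obj B; x \<in> Hom B Y (fobj F X)\<rbrakk>
    \<Longrightarrow> \<phi>' X Y (Comp B Y (fobj F X) (fobj F' X) (t X) x)
      = Comp A X (fobj G Y) (fobj G' Y) (s Y) (\<phi> X Y x)"
  shows "mates A B F G \<phi> F' G' \<phi>' t s"
  using assms by (simp add: mates_def)

text \<open>Evaluate the relation at \<open>\<psi> X Y y\<close> and apply \<open>\<psi>'\<close> to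
  both sides. This symmetry is what makes passing to mates involutive.\<close>

lemma mates_swap:
  assumes adj: "mutual_adjunction R A B F G \<phi> \<psi>" and adj': "mutual_adjunction R A B F' G' \<phi>' \<psi>'"
    and t: "nat_trans (op_cat A) B F F' t" and mates: "mates A B F G \<phi> F' G' \<phi>' t s"
  shows "mates B A G F (\<lambda>Y X. \<psi> X Y) G' F' (\<lambda>Y X. \<psi>' X Y) s t"
proof (rule matesI)
  interpret M: mutual_adjunction R A B F G \<phi> \<psi> by fact
  interpret M': mutual_adjunction R A B F' G' \<phi>' \<psi>' by fact
  fix Y X y assume "Y \<in> Obj B" "X \<in> Obj A" "y \<in> Hom A X (fobj G Y)"
  moreover from this have "t X \<in> Hom B (fobj F X) (fobj F' X)"
    using nat_transD(1)[OF t, of X] by simp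
  ultimately show "\<psi>' X Y (Comp A X (fobj G Y) (fobj G' Y) (s Y) y)
      = Comp B Y (fobj F X) (fobj F' X) (t X) (\<psi> X Y y)"
    using matesD[OF mates, of X Y "\<psi> X Y y"]
      M'.psi_phi[of X Y "Comp B Y (fobj F X) (fobj F' X) (t X) (\<psi> X Y y)"]
    by (simp add: M.phi_psi M.psi_closed M.F.cod.Comp_closed M.F_obj M'.F_obj)
qed

text \<open>Evaluating the relation at the element that corresponds to the identity of
  \<open>fobj G Y\<close> gives a formula for the component at \<open>Y\<close>.\<close>

lemma mates_unique:
  assumes adj: "mutual_adjunction R A B F G \<phi> \<psi>"
    and G': "\<And>Y. Y \<in> Obj B \<Longrightarrow> fobj G' Y \<in> Obj A"
    and "mates A B F G \<phi> F' G' \<phi>' t s" "mates A B F G \<phi> F' G' \<phi>' t s'"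
    and "Y \<in> Obj B" "s Y \<in> Hom A (fobj G Y) (fobj G' Y)" "s' Y \<in> Hom A (fobj G Y) (fobj G' Y)"
  shows "s Y = s' Y"
proof -
  interpret M: mutual_adjunction R A B F G \<phi> \<psi> by fact
  have eq: "r Y = \<phi>' (fobj G Y) Y (Comp B Y (fobj F (fobj G Y)) (fobj F' (fobj G Y)) (t (fobj G Y))
      (\<psi> (fobj G Y) Y (Ident A (fobj G Y))))"
    if "mates A B F G \<phi> F' G' \<phi>' t r" "r Y \<in> Hom A (fobj G Y) (fobj G' Y)" for r
    using assms(5) that(2) matesD[OF that(1), of "fobj G Y" Y "\<psi> (fobj G Y) Y (Ident A (fobj G Y))"]
    by (simp add: M.G_obj G' M.phi_psi M.psi_closed M.G.cod.Ident_closed M.G.cod.Comp_Ident_right)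
  show ?thesis using eq[OF assms(3,6)] eq[OF assms(4,7)] by simp
qed

text \<open>The formula forced by uniqueness is taken as the definition of \<open>s\<close>. The
  relation spreads from the universal element \<open>e Y\<close> to every \<open>x\<close>, because
  \<open>x\<close> is the restriction of \<open>e Y\<close> along \<open>\<phi> X Y x\<close> and
  both \<open>t\<close> and \<open>\<phi>'\<close> are natural.\<close>

lemma mates_exists:
  assumes adj: "mutual_adjunction R A B F G \<phi> \<psi>" and adj': "mutual_adjunction R A B F' G' \<phi>' \<psi>'"
    and t: "nat_trans (op_cat A) B F F' t"
  shows "\<exists>s. s \<in> extensional (Obj B) \<and> nat_trans (op_cat B) A G G' s \<and> mates A B F G \<phi> F' G' \<phi>' t s"
proof -
  interpret M: mutual_adjunction R A B F G \<phi> \<psi> by fact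
  interpret M': mutual_adjunction R A B F' G' \<phi>' \<psi>' by fact
  note [simp] = M.F_obj M.G_obj M.F_arr M.G_arr M'.F_obj M'.G_obj M'.F_arr M'.G_arr
    M.F.cod.Ident_closed M.F.cod.Comp_closed M.G.cod.Ident_closed M.G.cod.Comp_closed
    M.phi_closed M.psi_closed M'.phi_closed
  have [simp]: "t X \<in> Hom B (fobj F X) (fobj F' X)" if "X \<in> Obj A" for X
    using nat_transD(1)[OF t] that by simp
  have tnat: "Comp B (fobj F X) (fobj F X') (fobj F' X') (t X') (farr F X X' f)
      = Comp B (fobj F X) (fobj F' X) (fobj F' X') (farr F' X X' f) (t X)"
    if "X \<in> Obj A" "X' \<in> Obj A" "f \<in> Hom A X' X" for X X' f
    using nat_transD(2)[OF t] that by simp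
  define e where "e Y = \<psi> (fobj G Y) Y (Ident A (fobj G Y))" for Y
  define s where "s = (\<lambda>Y\<in>Obj B. \<phi>' (fobj G Y) Y
    (Comp B Y (fobj F (fobj G Y)) (fobj F' (fobj G Y)) (t (fobj G Y)) (e Y)))"
  have e [simp]: "e Y \<in> Hom B Y (fobj F (fobj G Y))" if "Y \<in> Obj B" for Y
    using that by (simp add: e_def)
  have s: "s Y \<in> Hom A (fobj G Y) (fobj G' Y)" if "Y \<in> Obj B" for Y
    using that by (simp add: s_def)
  have mates: "mates A B F G \<phi> F' G' \<phi>' t s"
  proof (rule matesI)
    fix X Y x assume X [simp]: "X \<in> Obj A" and Y [simp]: "Y \<in> Obj B" and x [simp]: "x \<in> Hom B Y (fobj F X)"
    have "x = Comp B Y (fobj F (fobj G Y)) (fobj F X) (farr F (fobj G Y) X (\<phi> X Y x)) (e Y)"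
      using M.psi_natural_left[of "fobj G Y" X Y "\<phi> X Y x" "Ident A (fobj G Y)"]
      by (simp add: e_def M.psi_phi M.G.cod.Comp_Ident_left)
    then have "Comp B Y (fobj F X) (fobj F' X) (t X) x = Comp B Y (fobj F X) (fobj F' X) (t X)
        (Comp B Y (fobj F (fobj G Y)) (fobj F X) (farr F (fobj G Y) X (\<phi> X Y x)) (e Y))"
      by simp
    also have "\<dots> = Comp B Y (fobj F' (fobj G Y)) (fobj F' X) (farr F' (fobj G Y) X (\<phi> X Y x))
        (Comp B Y (fobj F (fobj G Y)) (fobj F' (fobj G Y)) (t (fobj G Y)) (e Y))"
      by (simp add: M.F.cod.Comp_assoc tnat)
    finally show "\<phi>' X Y (Comp B Y (fobj F X) (fobj F' X) (t X) x)
        = Comp A X (fobj G Y) (fobj G' Y) (s Y) (\<phi> X Y x)"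
      by (simp add: M'.phi_natural_left s_def)
  qed
  have "nat_trans (op_cat B) A G G' s"
  proof (rule nat_transI)
    show "s Y \<in> Hom A (fobj G Y) (fobj G' Y)" if "Y \<in> Obj (op_cat B)" for Y
      using s that by simp
    fix Y Y' v assume "Y \<in> Obj (op_cat B)" "Y' \<in> Obj (op_cat B)" "v \<in> Hom (op_cat B) Y Y'"
    then have [simp]: "Y \<in> Obj B" "Y' \<in> Obj B" "v \<in> Hom B Y' Y" by simp_all
    \<comment> \<open>Both sides of the naturality square for \<open>s\<close> turn out to be the
      image under \<open>\<phi>'\<close> of the composite of \<open>v\<close>, \<open>e Y\<close>
      and \<open>t (fobj G Y)\<close>.\<close>
    have "\<phi> (fobj G Y) Y' (Comp B Y' Y (fobj F (fobj G Y)) (e Y) v) = farr G Y Y' v"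
      by (simp add: M.phi_natural_right e_def M.phi_psi M.G.cod.Comp_Ident_right)
    then have "Comp A (fobj G Y) (fobj G Y') (fobj G' Y') (s Y') (farr G Y Y' v)
        = \<phi>' (fobj G Y) Y' (Comp B Y' (fobj F (fobj G Y)) (fobj F' (fobj G Y)) (t (fobj G Y))
            (Comp B Y' Y (fobj F (fobj G Y)) (e Y) v))"
      using matesD[OF mates, of "fobj G Y" Y' "Comp B Y' Y (fobj F (fobj G Y)) (e Y) v"] by simp
    also have "\<dots> = Comp A (fobj G Y) (fobj G' Y) (fobj G' Y') (farr G' Y Y' v) (s Y)"
      by (simp add: M.F.cod.Comp_assoc M'.phi_natural_right s_def)
    finally show "Comp A (fobj G Y) (fobj G Y') (fobj G' Y') (s Y') (farr G Y Y' v)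
        = Comp A (fobj G Y) (fobj G' Y) (fobj G' Y') (farr G' Y Y' v) (s Y)" .
  qed
  then show ?thesis using mates by (auto simp: s_def)
qed

section \<open>The mate as an operation on morphisms of tensor products\<close>

text \<open>\<open>p\<close> packs a bijection with its inverse, so that an adjunction can be chosen
  as a single value for each functor.\<close>

definition adjoint where
  "adjoint R A B F G p \<longleftrightarrow> F \<in> Obj (LP_tensor R A B) \<and> G \<in> Obj (LP_tensor R B A) \<and>
     mutual_adjunction R A B F G (fst p) (snd p)"

definition flip where "flip p = ((\<lambda>Y X. snd p X Y), (\<lambda>Y X. fst p X Y))"

text \<open>Since \<open>mates\<close> constrains only components on \<open>Obj B\<close>, the
  description becomes unique by asking for an extensional transformation.\<close>

definition mate where
  "mate R A B F G p F' G' p' t =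
     (THE s. s \<in> Hom (LP_tensor R B A) G G' \<and> mates A B F G (fst p) F' G' (fst p') t s)"

lemma adjoint_flip: "adjoint R A B F G p \<Longrightarrow> adjoint R B A G F (flip p)"
  using mutual_adjunction.swap by (fastforce simp: adjoint_def flip_def)

lemma flip_flip [simp]: "flip (flip p) = p"
  by (simp add: flip_def)

lemma LP_tensor_Hom:
  "t \<in> Hom (LP_tensor R A B) F F' \<longleftrightarrow> t \<in> extensional (Obj A) \<and> nat_trans (op_cat A) B F F' t"
  by (simp add: LP_tensor_def Cont_simps)

lemma LP_tensor_Hom_app:
  "t \<in> Hom (LP_tensor R A B) F F' \<Longrightarrow> X \<in> Obj A \<Longrightarrow> t X \<in> Hom B (fobj F X) (fobj F' X)"
  using nat_transD(1)[of "op_cat A" B F F' t X] by (simp add: LP_tensor_Hom)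

lemma LP_tensor_simps:
  "Ident (LP_tensor R A B) F = (\<lambda>X\<in>Obj A. Ident B (fobj F X))"
  "Comp (LP_tensor R A B) F F' F'' s t =
    (\<lambda>X\<in>Obj A. Comp B (fobj F X) (fobj F' X) (fobj F'' X) (s X) (t X))"
  "hadd (LP_tensor R A B) F F' s t = (\<lambda>X\<in>Obj A. hadd B (fobj F X) (fobj F' X) (s X) (t X))"
  "hsmult (LP_tensor R A B) F F' a t = (\<lambda>X\<in>Obj A. hsmult B (fobj F X) (fobj F' X) a (t X))"
  by (simp_all add: LP_tensor_def Cont_simps)

text \<open>The tool for the algebra of mates: an identity for \<open>mate\<close> is proved by
  checking the relation \<open>mates\<close> for the expected value.\<close>

lemma mate_unique:
  assumes adj: "adjoint R A B F G p" and adj': "adjoint R A B F' G' p'"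
    and s: "s \<in> Hom (LP_tensor R B A) G G'" "mates A B F G (fst p) F' G' (fst p') t s"
  shows "mate R A B F G p F' G' p' t = s"
  unfolding mate_def
proof (rule the_equality)
  fix r assume r: "r \<in> Hom (LP_tensor R B A) G G' \<and> mates A B F G (fst p) F' G' (fst p') t r"
  interpret M': mutual_adjunction R A B F' G' "fst p'" "snd p'" using adj' by (simp add: adjoint_def)
  have "r Y = s Y" if "Y \<in> Obj B" for Y
    by (rule mates_unique[of R A B F G "fst p" "snd p" G'])
      (use adj r s that M'.G_obj LP_tensor_Hom_app in \<open>auto simp: adjoint_def\<close>)
  then show "r = s"
    using r s by (auto intro!: extensionalityI[of _ "Obj B"] simp: LP_tensor_Hom)
qed (use s in simp)

lemma
  assumes adj: "adjoint R A B F G p" and adj': "adjoint R A B F' G' p'"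
    and t: "t \<in> Hom (LP_tensor R A B) F F'"
  shows mate_closed: "mate R A B F G p F' G' p' t \<in> Hom (LP_tensor R B A) G G'"
    and mates_mate: "mates A B F G (fst p) F' G' (fst p') t (mate R A B F G p F' G' p' t)"
proof -
  obtain s where s: "s \<in> Hom (LP_tensor R B A) G G'" "mates A B F G (fst p) F' G' (fst p') t s"
    using mates_exists[of R A B F G "fst p" "snd p" F' G' "fst p'" "snd p'" t] adj adj' t
    by (auto simp: adjoint_def LP_tensor_Hom)
  then show "mate R A B F G p F' G' p' t \<in> Hom (LP_tensor R B A) G G'"
    "mates A B F G (fst p) F' G' (fst p') t (mate R A B F G p F' G' p' t)"
    using mate_unique[OF adj adj' s] by simp_all
qed

lemma mate_mate:
  assumes adj: "adjoint R A B F G p" and adj': "adjoint R A B F' G' p'"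
    and t: "t \<in> Hom (LP_tensor R A B) F F'"
  shows "mate R B A G F (flip p) G' F' (flip p') (mate R A B F G p F' G' p' t) = t"
  using mates_swap[of R A B F G "fst p" "snd p" F' G' "fst p'" "snd p'" t] mates_mate[OF assms] adj adj' t
  by (intro mate_unique adjoint_flip) (auto simp: flip_def adjoint_def LP_tensor_Hom)

lemma lin_category_LP_tensor:
  assumes "lin_category R A" "lin_category R B" "cring R"
  shows "lin_category R (LP_tensor R A B)"
  unfolding LP_tensor_def by (intro lin_category_Cont lin_category_op_cat assms)

lemma adjoint_lin_category:
  assumes adj: "adjoint R A B F G p" and R: "cring R"
  shows "lin_category R A" "lin_category R B"
    "lin_category R (LP_tensor R A B)" "lin_category R (LP_tensor R B A)"
proof -
  interpret M: mutual_adjunction R A B F G "fst p" "snd p" using adj by (simp add: adjoint_def)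
  show A: "lin_category R A" and B: "lin_category R B"
    by (fact M.G.cod.lin_category_axioms M.F.cod.lin_category_axioms)+
  show "lin_category R (LP_tensor R A B)" "lin_category R (LP_tensor R B A)"
    by (fact lin_category_LP_tensor[OF A B R] lin_category_LP_tensor[OF B A R])+
qed

lemma mate_Ident:
  assumes R: "cring R" and adj: "adjoint R A B F G p"
  shows "mate R A B F G p F G p (Ident (LP_tensor R A B) F) = Ident (LP_tensor R B A) G"
proof (rule mate_unique[OF adj adj])
  interpret M: mutual_adjunction R A B F G "fst p" "snd p" using adj by (simp add: adjoint_def)
  interpret T: lin_category R "LP_tensor R B A" by (rule adjoint_lin_category[OF adj R])
  show "Ident (LP_tensor R B A) G \<in> Hom (LP_tensor R B A) G G"
    using adj by (simp add: T.Ident_closed adjoint_def)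
  show "mates A B F G (fst p) F G (fst p) (Ident (LP_tensor R A B) F) (Ident (LP_tensor R B A) G)"
    by (rule matesI)
      (simp add: LP_tensor_simps M.F.cod.Comp_Ident_left M.G.cod.Comp_Ident_left M.F_obj M.G_obj M.phi_closed)
qed

text \<open>Mates paste: the relation for \<open>t\<close> is used at \<open>x\<close>, then the
  relation for \<open>t'\<close> at the composite of \<open>t X\<close> with
  \<open>x\<close>.\<close>

lemma mate_Comp:
  assumes R: "cring R" and adj: "adjoint R A B F G p" and adj': "adjoint R A B F' G' p'"
    and adj'': "adjoint R A B F'' G'' p''"
    and t: "t \<in> Hom (LP_tensor R A B) F F'" and t': "t' \<in> Hom (LP_tensor R A B) F' F''"
  shows "mate R A B F G p F'' G'' p'' (Comp (LP_tensor R A B) F F' F'' t' t)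
    = Comp (LP_tensor R B A) G G' G'' (mate R A B F' G' p' F'' G'' p'' t') (mate R A B F G p F' G' p' t)"
proof (rule mate_unique[OF adj adj''])
  interpret M: mutual_adjunction R A B F G "fst p" "snd p" using adj by (simp add: adjoint_def)
  interpret M': mutual_adjunction R A B F' G' "fst p'" "snd p'" using adj' by (simp add: adjoint_def)
  interpret M'': mutual_adjunction R A B F'' G'' "fst p''" "snd p''" using adj'' by (simp add: adjoint_def)
  interpret T: lin_category R "LP_tensor R B A" by (rule adjoint_lin_category[OF adj R])
  note s = mate_closed[OF adj adj' t] and s' = mate_closed[OF adj' adj'' t']
  show "Comp (LP_tensor R B A) G G' G'' (mate R A B F' G' p' F'' G'' p'' t') (mate R A B F G p F' G' p' t)
      \<in> Hom (LP_tensor R B A) G G''"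
    using adj adj' adj'' by (intro T.Comp_closed s s') (simp_all add: adjoint_def)
  show "mates A B F G (fst p) F'' G'' (fst p'') (Comp (LP_tensor R A B) F F' F'' t' t)
      (Comp (LP_tensor R B A) G G' G'' (mate R A B F' G' p' F'' G'' p'' t') (mate R A B F G p F' G' p' t))"
  proof (rule matesI)
    fix X Y x assume [simp]: "X \<in> Obj A" "Y \<in> Obj B" "x \<in> Hom B Y (fobj F X)"
    show "fst p'' X Y (Comp B Y (fobj F X) (fobj F'' X) (Comp (LP_tensor R A B) F F' F'' t' t X) x)
      = Comp A X (fobj G Y) (fobj G'' Y)
         (Comp (LP_tensor R B A) G G' G'' (mate R A B F' G' p' F'' G'' p'' t') (mate R A B F G p F' G' p' t) Y)
         (fst p X Y x)"
      using matesD[OF mates_mate[OF adj adj' t], of X Y x]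
        matesD[OF mates_mate[OF adj' adj'' t'], of X Y "Comp B Y (fobj F X) (fobj F' X) (t X) x"]
      by (simp add: LP_tensor_simps M.F_obj M'.F_obj M''.F_obj M.G_obj M'.G_obj M''.G_obj M.phi_closed
          M.F.cod.Comp_closed LP_tensor_Hom_app[OF t] LP_tensor_Hom_app[OF t']
          LP_tensor_Hom_app[OF s] LP_tensor_Hom_app[OF s']
          flip: M.F.cod.Comp_assoc M.G.cod.Comp_assoc)
  qed
qed

text \<open>The bijection \<open>fst p'\<close> is linear and composition is bilinear, so sums and
  multiples of mates satisfy the defining relation.\<close>

lemma mate_linear:
  assumes R: "cring R" and adj: "adjoint R A B F G p" and adj': "adjoint R A B F' G' p'"
  shows "mate R A B F G p F' G' p'
    \<in> mod_hom R (hom_module (LP_tensor R A B) F F') (hom_module (LP_tensor R B A) G G')"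
proof (rule mod_hom_hom_moduleI)
  interpret M: mutual_adjunction R A B F G "fst p" "snd p" using adj by (simp add: adjoint_def)
  interpret M': mutual_adjunction R A B F' G' "fst p'" "snd p'" using adj' by (simp add: adjoint_def)
  interpret T: lin_category R "LP_tensor R B A" by (rule adjoint_lin_category[OF adj R])
  have G: "G \<in> Obj (LP_tensor R B A)" "G' \<in> Obj (LP_tensor R B A)"
    using adj adj' by (simp_all add: adjoint_def)
  note [simp] = M.F_obj M'.F_obj M.G_obj M'.G_obj M.phi_closed M.F.cod.Comp_closed
  show "mate R A B F G p F' G' p' t \<in> Hom (LP_tensor R B A) G G'"
    if "t \<in> Hom (LP_tensor R A B) F F'" for t
    using mate_closed[OF adj adj' that] .
  show "mate R A B F G p F' G' p' (hadd (LP_tensor R A B) F F' t t')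
      = hadd (LP_tensor R B A) G G' (mate R A B F G p F' G' p' t) (mate R A B F G p F' G' p' t')"
    if t: "t \<in> Hom (LP_tensor R A B) F F'" and t': "t' \<in> Hom (LP_tensor R A B) F F'" for t t'
  proof (intro mate_unique[OF adj adj'] T.hadd_closed G mate_closed[OF adj adj'] t t' matesI)
    fix X Y x assume "X \<in> Obj A" "Y \<in> Obj B" "x \<in> Hom B Y (fobj F X)"
    then show "fst p' X Y (Comp B Y (fobj F X) (fobj F' X) (hadd (LP_tensor R A B) F F' t t' X) x)
      = Comp A X (fobj G Y) (fobj G' Y) (hadd (LP_tensor R B A) G G'
          (mate R A B F G p F' G' p' t) (mate R A B F G p F' G' p' t') Y) (fst p X Y x)"
      using matesD[OF mates_mate[OF adj adj' t], of X Y x] matesD[OF mates_mate[OF adj adj' t'], of X Y x]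
        LP_tensor_Hom_app[OF mate_closed[OF adj adj' t]] LP_tensor_Hom_app[OF mate_closed[OF adj adj' t']]
      by (simp add: LP_tensor_simps LP_tensor_Hom_app[OF t] LP_tensor_Hom_app[OF t']
          M.F.cod.Comp_hadd_left M.G.cod.Comp_hadd_left M'.phi_hadd)
  qed
  show "mate R A B F G p F' G' p' (hsmult (LP_tensor R A B) F F' a t)
      = hsmult (LP_tensor R B A) G G' a (mate R A B F G p F' G' p' t)"
    if a: "a \<in> carrier R" and t: "t \<in> Hom (LP_tensor R A B) F F'" for a t
  proof (intro mate_unique[OF adj adj'] T.hsmult_closed G mate_closed[OF adj adj'] a t matesI)
    fix X Y x assume "X \<in> Obj A" "Y \<in> Obj B" "x \<in> Hom B Y (fobj F X)"
    then show "fst p' X Y (Comp B Y (fobj F X) (fobj F' X) (hsmult (LP_tensor R A B) F F' a t X) x)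
      = Comp A X (fobj G Y) (fobj G' Y) (hsmult (LP_tensor R B A) G G' a
          (mate R A B F G p F' G' p' t) Y) (fst p X Y x)"
      using matesD[OF mates_mate[OF adj adj' t], of X Y x] a
        LP_tensor_Hom_app[OF mate_closed[OF adj adj' t]]
      by (simp add: LP_tensor_simps LP_tensor_Hom_app[OF t]
          M.F.cod.Comp_hsmult_left M.G.cod.Comp_hsmult_left M'.phi_hsmult)
  qed
qed

text \<open>Two adjoints of the same functor are canonically isomorphic: the mates of its identity
  in the two directions compose to the mate of that identity for a single adjunction, which is an
  identity.\<close>

lemma is_iso_mate_Ident:
  assumes R: "cring R" and adj: "adjoint R A B F G p" and adj': "adjoint R A B F G' p'"
  shows "is_iso (LP_tensor R B A) G G' (mate R A B F G p F G' p' (Ident (LP_tensor R A B) F))"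
proof -
  interpret T: lin_category R "LP_tensor R A B" by (rule adjoint_lin_category[OF adj R])
  have F: "F \<in> Obj (LP_tensor R A B)" using adj by (simp add: adjoint_def)
  note I = T.Ident_closed[OF F]
  have "Comp (LP_tensor R B A) G1 G2 G1 (mate R A B F G2 p2 F G1 p1 (Ident (LP_tensor R A B) F))
      (mate R A B F G1 p1 F G2 p2 (Ident (LP_tensor R A B) F)) = Ident (LP_tensor R B A) G1"
    if adj1: "adjoint R A B F G1 p1" and adj2: "adjoint R A B F G2 p2" for G1 G2 p1 p2
    using mate_Comp[OF R adj1 adj2 adj1 I I] mate_Ident[OF R adj1] by (simp add: T.Comp_Ident_left F I)
  then show ?thesis
    unfolding is_iso_def using adj adj' mate_closed[OF adj adj' I] mate_closed[OF adj' adj I] by blast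
qed

section \<open>The functors given by mates and the equivalence\<close>

definition mate_ftor where
  "mate_ftor R A B T p =
     \<lparr>fobj = T, farr = (\<lambda>F F'. mate R A B F (T F) (p F) F' (T F') (p F'))\<rparr>"

lemma lin_functor_mate_ftor:
  assumes A: "lin_category R A" and B: "lin_category R B" and R: "cring R"
    and adj: "\<And>F. F \<in> Obj (LP_tensor R A B) \<Longrightarrow> adjoint R A B F (T F) (p F)"
  shows "lin_functor R (LP_tensor R A B) (LP_tensor R B A) (mate_ftor R A B T p)"
proof -
  interpret AB: lin_category R "LP_tensor R A B" by (rule lin_category_LP_tensor[OF A B R])
  interpret BA: lin_category R "LP_tensor R B A" by (rule lin_category_LP_tensor[OF B A R])
  show ?thesis
    by (intro lin_functor.intro cat_functor.intro cat_functor_axioms.intro lin_functor_axioms.intro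
        AB.category_axioms BA.category_axioms AB.lin_category_axioms BA.lin_category_axioms)
      (simp_all add: mate_ftor_def adj adj[unfolded adjoint_def] mate_closed mate_Ident[OF R]
        mate_Comp[OF R] mate_linear[OF R])
qed

theorem proposition8p10:
  fixes R :: "'k ring"
    and A :: "('k, 'a, 'u) lincat"
    and B :: "('k, 'b, 'u) lincat"
  assumes "universe TYPE('u)"
    and "cring R"
    and "small TYPE('u) (carrier R)"
    and "locally_presentable R A"
    and "locally_presentable R B"
  shows "lin_equivalent R (LP_tensor R A B) (LP_tensor R B A)"
proof -
  note R = \<open>cring R\<close>
  have A: "lin_category R A" and B: "lin_category R B"
    using assms(4,5) by (auto simp: locally_presentable_def locally_presentable_at_def)
  interpret AB: lin_category R "LP_tensor R A B" by (rule lin_category_LP_tensor[OF A B R])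
  interpret BA: lin_category R "LP_tensor R B A" by (rule lin_category_LP_tensor[OF B A R])
  \<comment> \<open>An adjoint and its adjunction data are chosen together as a pair, so that
    \<open>T\<close> and \<open>p\<close> fit each other.\<close>
  have "\<forall>F\<in>Obj (LP_tensor R A B). \<exists>r. adjoint R A B F (fst r) (snd r)"
    using LP_tensor_adjoint[OF assms(1,4,5)] by (fastforce simp: adjoint_def)
  then obtain r where r: "\<forall>F\<in>Obj (LP_tensor R A B). adjoint R A B F (fst (r F)) (snd (r F))"
    using bchoice[of "Obj (LP_tensor R A B)" "\<lambda>F r. adjoint R A B F (fst r) (snd r)"] by blast
  define T p where "T F = fst (r F)" and "p F = snd (r F)" for F
  have T: "adjoint R A B F (T F) (p F)" if "F \<in> Obj (LP_tensor R A B)" for F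
    using r that by (simp add: T_def p_def)
  have "\<forall>G\<in>Obj (LP_tensor R B A). \<exists>r. adjoint R B A G (fst r) (snd r)"
    using LP_tensor_adjoint[OF assms(1,5,4)] by (fastforce simp: adjoint_def)
  then obtain r' where r': "\<forall>G\<in>Obj (LP_tensor R B A). adjoint R B A G (fst (r' G)) (snd (r' G))"
    using bchoice[of "Obj (LP_tensor R B A)" "\<lambda>G r. adjoint R B A G (fst r) (snd r)"] by blast
  define T' p' where "T' G = fst (r' G)" and "p' G = snd (r' G)" for G
  have T': "adjoint R B A G (T' G) (p' G)" if "G \<in> Obj (LP_tensor R B A)" for G
    using r' that by (simp add: T'_def p'_def)
  have TObj: "T F \<in> Obj (LP_tensor R B A)" if "F \<in> Obj (LP_tensor R A B)" for F
    using T[OF that] by (simp add: adjoint_def)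
  have T'Obj: "T' G \<in> Obj (LP_tensor R A B)" if "G \<in> Obj (LP_tensor R B A)" for G
    using T'[OF that] by (simp add: adjoint_def)
  define P Q where "P = mate_ftor R A B T p" and "Q = mate_ftor R B A T' p'"
  \<comment> \<open>\<open>T F\<close> has two adjoints: \<open>F\<close> itself by the flipped
    adjunction, and the chosen \<open>T' (T F)\<close>. The mate of the identity of
    \<open>T F\<close> compares them.\<close>
  define \<eta> where "\<eta> F = mate R B A (T F) F (flip (p F)) (T F) (T' (T F)) (p' (T F))
    (Ident (LP_tensor R B A) (T F))" for F
  \<comment> \<open>Likewise \<open>T' G\<close> has the adjoints \<open>T (T' G)\<close> and
    \<open>G\<close>, compared in this order.\<close>
  define \<epsilon> where "\<epsilon> G = mate R A B (T' G) (T (T' G)) (p (T' G)) (T' G) G (flip (p' G))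
    (Ident (LP_tensor R A B) (T' G))" for G
  have "nat_iso (LP_tensor R A B) (LP_tensor R A B) id_ftor (comp_ftor Q P) \<eta>"
    unfolding nat_iso_def
  proof (intro conjI ballI nat_transI)
    have iso: "is_iso (LP_tensor R A B) F (T' (T F)) (\<eta> F)" if "F \<in> Obj (LP_tensor R A B)" for F
      unfolding \<eta>_def by (intro is_iso_mate_Ident R adjoint_flip T T' TObj that)
    then show "is_iso (LP_tensor R A B) (fobj id_ftor F) (fobj (comp_ftor Q P) F) (\<eta> F)"
      if "F \<in> Obj (LP_tensor R A B)" for F
      using that by (simp add: id_ftor_def comp_ftor_def P_def Q_def mate_ftor_def)
    then show "\<eta> F \<in> Hom (LP_tensor R A B) (fobj id_ftor F) (fobj (comp_ftor Q P) F)"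
      if "F \<in> Obj (LP_tensor R A B)" for F
      using that unfolding is_iso_def by blast
    fix F F' t assume F: "F \<in> Obj (LP_tensor R A B)" and F': "F' \<in> Obj (LP_tensor R A B)"
      and t: "t \<in> Hom (LP_tensor R A B) F F'"
    define s where "s = mate R A B F (T F) (p F) F' (T F') (p F') t"
    have s: "s \<in> Hom (LP_tensor R B A) (T F) (T F')"
      unfolding s_def by (rule mate_closed[OF T[OF F] T[OF F'] t])
    \<comment> \<open>Since \<open>t\<close> is the mate of its mate \<open>s\<close>, both sides of
      the naturality square become composites of mates. Each equals the mate of \<open>s\<close>
      formed with \<open>F\<close> as adjoint at the source and \<open>T' (T F')\<close> at the
      target.\<close>
    have ts: "t = mate R B A (T F) F (flip (p F)) (T F') F' (flip (p F')) s"
      unfolding s_def by (rule mate_mate[OF T[OF F] T[OF F'] t, symmetric])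
    note I = BA.Ident_closed[OF TObj[OF F]] BA.Ident_closed[OF TObj[OF F']]
    note a = adjoint_flip[OF T[OF F]] adjoint_flip[OF T[OF F']] T'[OF TObj[OF F]] T'[OF TObj[OF F']]
    have "Comp (LP_tensor R A B) F F' (T' (T F')) (\<eta> F') t
        = mate R B A (T F) F (flip (p F)) (T F') (T' (T F')) (p' (T F')) s"
      unfolding \<eta>_def using mate_Comp[OF R a(1,2,4) s I(2)] s
      by (simp add: ts[symmetric] BA.Comp_Ident_left TObj F F')
    also have "\<dots> = Comp (LP_tensor R A B) F (T' (T F)) (T' (T F'))
        (mate R B A (T F) (T' (T F)) (p' (T F)) (T F') (T' (T F')) (p' (T F')) s) (\<eta> F)"
      unfolding \<eta>_def using mate_Comp[OF R a(1,3,4) I(1) s] s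
      by (simp add: BA.Comp_Ident_right TObj F F')
    finally show "Comp (LP_tensor R A B) (fobj id_ftor F) (fobj id_ftor F') (fobj (comp_ftor Q P) F') (\<eta> F')
          (farr id_ftor F F' t)
        = Comp (LP_tensor R A B) (fobj id_ftor F) (fobj (comp_ftor Q P) F) (fobj (comp_ftor Q P) F')
          (farr (comp_ftor Q P) F F' t) (\<eta> F)"
      by (simp add: id_ftor_def comp_ftor_def P_def Q_def mate_ftor_def s_def)
  qed
  moreover have "nat_iso (LP_tensor R B A) (LP_tensor R B A) (comp_ftor P Q) id_ftor \<epsilon>"
    unfolding nat_iso_def
  proof (intro conjI ballI nat_transI)
    have iso: "is_iso (LP_tensor R B A) (T (T' G)) G (\<epsilon> G)" if "G \<in> Obj (LP_tensor R B A)" for G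
      unfolding \<epsilon>_def by (intro is_iso_mate_Ident R adjoint_flip T T' T'Obj that)
    then show "is_iso (LP_tensor R B A) (fobj (comp_ftor P Q) G) (fobj id_ftor G) (\<epsilon> G)"
      if "G \<in> Obj (LP_tensor R B A)" for G
      using that by (simp add: id_ftor_def comp_ftor_def P_def Q_def mate_ftor_def)
    then show "\<epsilon> G \<in> Hom (LP_tensor R B A) (fobj (comp_ftor P Q) G) (fobj id_ftor G)"
      if "G \<in> Obj (LP_tensor R B A)" for G
      using that unfolding is_iso_def by blast
    fix G G' s assume G: "G \<in> Obj (LP_tensor R B A)" and G': "G' \<in> Obj (LP_tensor R B A)"
      and s: "s \<in> Hom (LP_tensor R B A) G G'"
    define t where "t = mate R B A G (T' G) (p' G) G' (T' G') (p' G') s"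
    have t: "t \<in> Hom (LP_tensor R A B) (T' G) (T' G')"
      unfolding t_def by (rule mate_closed[OF T'[OF G] T'[OF G'] s])
    \<comment> \<open>By the same argument both sides of this square equal the mate of
      \<open>t\<close> from \<open>T (T' G)\<close> to \<open>G'\<close>.\<close>
    have st: "s = mate R A B (T' G) G (flip (p' G)) (T' G') G' (flip (p' G')) t"
      unfolding t_def by (rule mate_mate[OF T'[OF G] T'[OF G'] s, symmetric])
    note I = AB.Ident_closed[OF T'Obj[OF G]] AB.Ident_closed[OF T'Obj[OF G']]
    note a = adjoint_flip[OF T'[OF G]] adjoint_flip[OF T'[OF G']] T[OF T'Obj[OF G]] T[OF T'Obj[OF G']]
    have "Comp (LP_tensor R B A) (T (T' G)) (T (T' G')) G' (\<epsilon> G')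
          (mate R A B (T' G) (T (T' G)) (p (T' G)) (T' G') (T (T' G')) (p (T' G')) t)
        = mate R A B (T' G) (T (T' G)) (p (T' G)) (T' G') G' (flip (p' G')) t"
      unfolding \<epsilon>_def using mate_Comp[OF R a(3,4,2) t I(2)] t
      by (simp add: AB.Comp_Ident_left T'Obj G G')
    also have "\<dots> = Comp (LP_tensor R B A) (T (T' G)) G G' s (\<epsilon> G)"
      unfolding \<epsilon>_def using mate_Comp[OF R a(3,1,2) I(1) t] t
      by (simp add: st[symmetric] AB.Comp_Ident_right T'Obj G G')
    finally show "Comp (LP_tensor R B A) (fobj (comp_ftor P Q) G) (fobj (comp_ftor P Q) G') (fobj id_ftor G') (\<epsilon> G')
          (farr (comp_ftor P Q) G G' s)
        = Comp (LP_tensor R B A) (fobj (comp_ftor P Q) G) (fobj id_ftor G) (fobj id_ftor G')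
          (farr id_ftor G G' s) (\<epsilon> G)"
      by (simp add: id_ftor_def comp_ftor_def P_def Q_def mate_ftor_def t_def)
  qed
  moreover have "lin_functor R (LP_tensor R A B) (LP_tensor R B A) P"
    unfolding P_def by (rule lin_functor_mate_ftor[OF A B R T])
  moreover have "lin_functor R (LP_tensor R B A) (LP_tensor R A B) Q"
    unfolding Q_def by (rule lin_functor_mate_ftor[OF B A R T'])
  ultimately show ?thesis unfolding lin_equivalent_def by blast
qed

end
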